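(* Let $\delta\ge 0$ and let $\mathcal{C}_\delta$ be the class of finite $\delta$-hyperbolic metric spaces with rational distances, considered as a marked class with all $\delta$-closed subspaces as distinguished substructures. Then the marked Fraïssé limit $\mathbb{H}_\delta$ of $\mathcal{C}_\delta$ exists and is homogeneous and universal for finite $\delta$-closed subspaces: every finite $\delta$-hyperbolic space with rational distances is isometric to a $\delta$-closed subspace of $\mathbb{H}_\delta$, and every isometry between finite $\delta$-closed subspaces of $\mathbb{H}_\delta$ extends to an isometry of $\mathbb{H}_\delta$ onto itself.
   Context: A metric space $(X,d)$ is $\delta$-hyperbolic if for all $x_1,\dots,x_4\in X$ one has $d(x_1,x_4)+d(x_2,x_3)\le\max\{d(x_1,x_2)+d(x_3,x_4),\,d(x_1,x_3)+d(x_2,x_4)\}+2\delta$. A subset $A$ of a metric space $X$ is gated in $X$ if for every $b\in X\setminus A$ there is a (necessarily unique) gate $g_A(b)\in A$ such that $d(b,a)=d(b,g_A(b))+d(g_A(b),a)$ for all $a\in A$. A nonempty $A\subseteq X$ is $\delta$-closed in $X$ if $A$ is gated in $X$ and for all $b,b'\in X\setminus A$ with $d(g_A(b),g_A(b'))>\delta$ we have $d(b,b')=d(b,g_A(b))+d(g_A(b),g_A(b'))+d(g_A(b'),b')$. A marked metric space is a metric space with an at most countable class of distinguished subspaces, closed under (nonempty) intersections. An isomorphism of marked metric spaces is a bijective isometry inducing a bijection between the sets of distinguished subspaces. A distinguished subspace $A'$ of $B$ is itself marked by the distinguished subspaces of $B$ contained in $A'$. An embedding of marked spaces $f:A\to B$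 is an isometric embedding such that $f(A)$ is distinguished in $B$ and $f:A\to f(A)$ is an isomorphism of marked spaces. A marked Fraïssé limit of a class $\mathcal{C}$ of marked spaces is a marked space $\mathbb{M}$ such that: (age) every distinguished subspace of $\mathbb{M}$ belongs to $\mathcal{C}$; (cofinal) $\mathbb{M}$ is the union of a countable chain of distinguished subspaces; (universal) every $A\in\mathcal{C}$ embeds into $\mathbb{M}$; (homogeneous) every isomorphism (of marked spaces) between distinguished subspaces of $\mathbb{M}$ extends to an automorphism of $\mathbb{M}$. *)

theory Defs
  imports "HOL-Analysis.Analysis"
begin

definition hyperbolic :: "real \<Rightarrow> 'a metric \<Rightarrow> bool" where
  "hyperbolic \<delta> m \<longleftrightarrow>
     (\<forall>x1\<in>mspace m. \<forall>x2\<in>mspace m. \<forall>x3\<in>mspace m. \<forall>x4\<in>mspace m.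
        mdist m x1 x4 + mdist m x2 x3
          \<le> max (mdist m x1 x2 + mdist m x3 x4) (mdist m x1 x3 + mdist m x2 x4) + 2 * \<delta>)"

definition rational_distances :: "'a metric \<Rightarrow> bool" where
  "rational_distances m \<longleftrightarrow> (\<forall>x\<in>mspace m. \<forall>y\<in>mspace m. mdist m x y \<in> \<rat>)"

definition is_gate :: "'a metric \<Rightarrow> 'a set \<Rightarrow> 'a \<Rightarrow> 'a \<Rightarrow> bool" where
  "is_gate m A b g \<longleftrightarrow> g \<in> A \<and> (\<forall>a\<in>A. mdist m b a = mdist m b g + mdist m g a)"

definition gate :: "'a metric \<Rightarrow> 'a set \<Rightarrow> 'a \<Rightarrow> 'a" where
  "gate m A b = (THE g. is_gate m A b g)"

definition gated :: "'a metric \<Rightarrow> 'a set \<Rightarrow> bool" where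
  "gated m A \<longleftrightarrow> A \<subseteq> mspace m \<and> (\<forall>b \<in> mspace m - A. \<exists>g. is_gate m A b g)"

lemma is_gate_unique:
  assumes "A \<subseteq> mspace m" "is_gate m A b g" "is_gate m A b h"
  shows "g = h"
proof -
  have gh: "g \<in> mspace m" "h \<in> mspace m"
    using assms unfolding is_gate_def by blast+
  have "mdist m b h = mdist m b g + mdist m g h" "mdist m b g = mdist m b h + mdist m h g"
    using assms(2,3) unfolding is_gate_def by blast+
  then have "mdist m g h = 0"
    using mdist_commute[of m g h] by linarith
  then show ?thesis
    using gh by simp
qed

lemma is_gate_gate:
  assumes "gated m A" "b \<in> mspace m - A"
  shows "is_gate m A b (gate m A b)"
proof -
  have sub: "A \<subseteq> mspace m" and "\<exists>g. is_gate m A b g"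
    using assms unfolding gated_def by blast+
  then obtain g where g: "is_gate m A b g"
    by blast
  show ?thesis
    unfolding gate_def by (rule theI[of _ g]) (fact g, rule is_gate_unique[OF sub _ g])
qed

definition delta_closed :: "real \<Rightarrow> 'a metric \<Rightarrow> 'a set \<Rightarrow> bool" where
  "delta_closed \<delta> m A \<longleftrightarrow> A \<noteq> {} \<and> gated m A \<and>
     (\<forall>b \<in> mspace m - A. \<forall>b' \<in> mspace m - A.
        mdist m (gate m A b) (gate m A b') > \<delta> \<longrightarrow>
        mdist m b b' = mdist m b (gate m A b) + mdist m (gate m A b) (gate m A b')
                        + mdist m (gate m A b') b')"

definition isometry :: "'a metric \<Rightarrow> 'b metric \<Rightarrow> ('a \<Rightarrow> 'b) \<Rightarrow> bool" where
  "isometry m m' f \<longleftrightarrow> bij_betw f (mspace m) (mspace m') \<and>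
     (\<forall>x\<in>mspace m. \<forall>y\<in>mspace m. mdist m' (f x) (f y) = mdist m x y)"

text \<open>The class of distinguished subspaces is represented by the set of their carriers.\<close>

record 'a marked =
  space_of :: "'a metric"
  marks :: "'a set set"

abbreviation points :: "'a marked \<Rightarrow> 'a set" where
  "points A \<equiv> mspace (space_of A)"

definition marked_space :: "'a marked \<Rightarrow> bool" where
  "marked_space A \<longleftrightarrow> marks A \<subseteq> Pow (points A) \<and> countable (marks A) \<and>
     (\<forall>F. F \<subseteq> marks A \<and> F \<noteq> {} \<and> \<Inter>F \<noteq> {} \<longrightarrow> \<Inter>F \<in> marks A)"

definition marked_subspace :: "'a marked \<Rightarrow> 'a set \<Rightarrow> 'a marked" where
  "marked_subspace A S =
     \<lparr>space_of = submetric (space_of A) S, marks = {T \<in> marks A. T \<subseteq> S}\<rparr>"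

definition marked_iso :: "'a marked \<Rightarrow> 'b marked \<Rightarrow> ('a \<Rightarrow> 'b) \<Rightarrow> bool" where
  "marked_iso A B f \<longleftrightarrow> isometry (space_of A) (space_of B) f \<and>
     bij_betw (\<lambda>S. f ` S) (marks A) (marks B)"

definition marked_embedding :: "'a marked \<Rightarrow> 'b marked \<Rightarrow> ('a \<Rightarrow> 'b) \<Rightarrow> bool" where
  "marked_embedding A B f \<longleftrightarrow> f ` points A \<in> marks B \<and>
     marked_iso A (marked_subspace B (f ` points A)) f"

text \<open>
  A class of marked spaces is given by a set of representatives over one carrier type; a marked
  space over an arbitrary type belongs to the class if it is isomorphic to a representative.
\<close>

definition belongs_to :: "'b marked \<Rightarrow> 'a marked set \<Rightarrow> bool" where
  "belongs_to B C \<longleftrightarrow> (\<exists>A\<in>C. \<exists>f. marked_iso A B f)"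

definition marked_fraisse_limit :: "'c marked set \<Rightarrow> 'a marked \<Rightarrow> bool" where
  "marked_fraisse_limit C M \<longleftrightarrow>
     marked_space M \<and>
     (\<forall>A\<in>marks M. belongs_to (marked_subspace M A) C) \<and>
     (\<exists>A :: nat \<Rightarrow> 'a set. range A \<subseteq> marks M \<and> incseq A \<and> (\<Union>n. A n) = points M) \<and>
     (\<forall>A\<in>C. \<exists>f. marked_embedding A M f) \<and>
     (\<forall>A\<in>marks M. \<forall>B\<in>marks M. \<forall>f.
        marked_iso (marked_subspace M A) (marked_subspace M B) f \<longrightarrow>
        (\<exists>h. marked_iso M M h \<and> (\<forall>x\<in>A. h x = f x)))"

text \<open>
  Every finite metric space has an isometric copy whose carrier consists of natural numbers, so
  this set represents all isomorphism types of the class. Since \<open>\<delta>\<close>-closed subspaces are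
  nonempty and a space is \<open>\<delta>\<close>-closed in itself, members of the class are nonempty.
\<close>

definition hyperbolic_class :: "real \<Rightarrow> nat marked set" where
  "hyperbolic_class \<delta> =
     {A. finite (points A) \<and> points A \<noteq> {} \<and> hyperbolic \<delta> (space_of A) \<and>
         rational_distances (space_of A) \<and> marks A = {S. delta_closed \<delta> (space_of A) S}}"

end

theory Submission
  imports Defs
begin

text \<open>
  Gluing two finite spaces along a common \<open>\<delta>\<close>-closed subspace \<open>S\<close>, with the distance between points
  on different sides measured through their gates in \<open>S\<close>, keeps both sides \<open>\<delta>\<close>-closed and preserves
  the four-point condition: if the gates of two points are more than \<open>\<delta>\<close> apart, the points may be
  replaced by their gates; otherwise all error terms are at most \<open>2 * \<delta>\<close>. Since singletons are
  \<open>\<delta>\<close>-closed, this also yields joint embedding, so a chain of finite spaces solving all countably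
  many extension problems has a limit.

  In a limit the distinguished subspaces are exactly the finite \<open>\<delta>\<close>-closed subsets of the whole space:
  any such set and any of its points lie in a member of the cofinal chain. Hence the marks carry no
  information beyond the metric, and uniqueness and homogeneity follow by back and forth between
  finite \<open>\<delta>\<close>-closed subsets.
\<close>

section \<open>Closed subspaces\<close>

text \<open>In general a free amalgam measures crossing distances by an infimum over the common
  part. Gates turn this into a sum of three terms, so rationality survives and the triangle
  inequality becomes a check on which legs cross from one side to the other. The constants fit
  together: each side may contribute an error of \<delta> when its gates are close, and the
  four-point condition tolerates 2 \<delta>. The other obstacle is that a limit comes with abstract
  marks on an arbitrary type. Both halves of the proof therefore meet in the purely metric notion
  \<open>hyperbolic_limit\<close>, whose core is the one-sided extension property
  \<open>closed_extending\<close>: the chain is built to satisfy it, universality and homogeneity of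
  any limit yield it, and it drives the back and forth.\<close>

lemma mdist_same [simp]: "x \<in> mspace m \<Longrightarrow> mdist m x x = 0"
  by simp

lemma is_gate_in: "is_gate m A b g \<Longrightarrow> g \<in> A"
  by (simp add: is_gate_def)

lemma is_gate_dist:
  "is_gate m A b g \<Longrightarrow> a \<in> A \<Longrightarrow> mdist m b a = mdist m b g + mdist m g a"
  unfolding is_gate_def by blast

lemma is_gateI:
  "g \<in> A \<Longrightarrow> (\<And>a. a \<in> A \<Longrightarrow> mdist m b a = mdist m b g + mdist m g a) \<Longrightarrow> is_gate m A b g"
  unfolding is_gate_def by blast

lemma is_gate_mono: "is_gate m A b g \<Longrightarrow> g \<in> B \<Longrightarrow> B \<subseteq> A \<Longrightarrow> is_gate m B b g"
  unfolding is_gate_def by blast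

lemma is_gate_self: "A \<subseteq> mspace m \<Longrightarrow> x \<in> A \<Longrightarrow> is_gate m A x x"
  by (auto simp: is_gate_def)

lemma is_gate_submetric [simp]: "is_gate (submetric m B) = is_gate m"
  by (simp add: fun_eq_iff is_gate_def)

lemma gate_eq: "A \<subseteq> mspace m \<Longrightarrow> is_gate m A b g \<Longrightarrow> gate m A b = g"
  unfolding gate_def by (rule the_equality) (auto intro: is_gate_unique)

text \<open>A point of \<open>A\<close> is its own gate, and if one of two points lies in
  \<open>A\<close>, the required additivity is already the gate equation of the other. Extending
  both clauses from the complement to all of \<open>mspace m\<close> thus costs nothing and avoids
  case distinctions later.\<close>

lemma delta_closed_iff:
  "delta_closed \<delta> m A \<longleftrightarrow> A \<noteq> {} \<and> A \<subseteq> mspace m \<and> (\<forall>x\<in>mspace m. \<exists>g. is_gate m A x g) \<and>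
     (\<forall>x\<in>mspace m. \<forall>y\<in>mspace m. \<forall>g h. is_gate m A x g \<longrightarrow> is_gate m A y h \<longrightarrow>
        \<delta> < mdist m g h \<longrightarrow> mdist m x y = mdist m x g + mdist m g h + mdist m h y)"
  (is "?L \<longleftrightarrow> ?R")
proof
  assume L: ?L
  then have sub: "A \<subseteq> mspace m" and ne: "A \<noteq> {}"
    by (auto simp: delta_closed_def gated_def)
  have ex: "\<exists>g. is_gate m A x g" if "x \<in> mspace m" for x
    using L that is_gate_self[OF sub] unfolding delta_closed_def gated_def by blast
  have "mdist m x y = mdist m x g + mdist m g h + mdist m h y"
    if x: "x \<in> mspace m" and y: "y \<in> mspace m"
      and g: "is_gate m A x g" and h: "is_gate m A y h" and d: "\<delta> < mdist m g h" for x y g h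
  proof -
    have gm: "g \<in> A" "h \<in> A"
      using g h by (auto dest: is_gate_in)
    consider "x \<in> A" | "y \<in> A" | "x \<notin> A" "y \<notin> A" by blast
    then show ?thesis
    proof cases
      case 1
      then have "g = x" using is_gate_unique[OF sub g is_gate_self[OF sub]] by blast
      moreover have "mdist m y x = mdist m y h + mdist m h x"
        by (rule is_gate_dist[OF h 1])
      ultimately show ?thesis using x by (simp add: mdist_commute)
    next
      case 2
      then have "h = y" using is_gate_unique[OF sub h is_gate_self[OF sub]] by blast
      moreover have "mdist m x y = mdist m x g + mdist m g y"
        by (rule is_gate_dist[OF g 2])
      ultimately show ?thesis using y by simp
    next
      case 3
      then show ?thesis
        using L x y d gate_eq[OF sub g] gate_eq[OF sub h] unfolding delta_closed_def by auto
    qed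
  qed
  then show ?R using sub ne ex by blast
next
  assume R: ?R
  then have "gated m A" unfolding gated_def by blast
  then show ?L
    using R is_gate_gate[of m A] unfolding delta_closed_def by (metis DiffD1)
qed

lemma delta_closed_subset: "delta_closed \<delta> m A \<Longrightarrow> A \<subseteq> mspace m"
  by (simp add: delta_closed_iff)

lemma delta_closed_gate: "delta_closed \<delta> m A \<Longrightarrow> x \<in> mspace m \<Longrightarrow> \<exists>g. is_gate m A x g"
  by (simp add: delta_closed_iff)

lemma delta_closed_nonempty: "delta_closed \<delta> m A \<Longrightarrow> A \<noteq> {}"
  by (simp add: delta_closed_iff)

text \<open>An explicit function in place of the description operator in \<open>gate\<close>. By
  uniqueness it fixes \<open>A\<close>, so it is a retraction, and retractions can be composed and
  restricted.\<close>

definition gate_map :: "real \<Rightarrow> 'a metric \<Rightarrow> 'a set \<Rightarrow> ('a \<Rightarrow> 'a) \<Rightarrow> bool" where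
  "gate_map \<delta> m A p \<longleftrightarrow> A \<noteq> {} \<and> A \<subseteq> mspace m \<and> (\<forall>x\<in>mspace m. is_gate m A x (p x)) \<and>
     (\<forall>x\<in>mspace m. \<forall>y\<in>mspace m. \<delta> < mdist m (p x) (p y) \<longrightarrow>
        mdist m x y = mdist m x (p x) + mdist m (p x) (p y) + mdist m (p y) y)"

lemma gate_mapI:
  assumes "A \<noteq> {}" and "A \<subseteq> mspace m"
    and "\<And>x. x \<in> mspace m \<Longrightarrow> is_gate m A x (p x)"
    and "\<And>x y. x \<in> mspace m \<Longrightarrow> y \<in> mspace m \<Longrightarrow> \<delta> < mdist m (p x) (p y) \<Longrightarrow>
      mdist m x y = mdist m x (p x) + mdist m (p x) (p y) + mdist m (p y) y"
  shows "gate_map \<delta> m A p"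
  using assms unfolding gate_map_def by simp

lemma gate_map_delta_closed:
  assumes "gate_map \<delta> m A p" shows "delta_closed \<delta> m A"
proof -
  have sub: "A \<subseteq> mspace m" and p: "\<forall>x\<in>mspace m. is_gate m A x (p x)"
    using assms by (auto simp: gate_map_def)
  have "g = p x" if "x \<in> mspace m" "is_gate m A x g" for x g
    using is_gate_unique[OF sub] p that by blast
  then show ?thesis
    using assms unfolding gate_map_def delta_closed_iff by blast
qed

lemmas delta_closedI = gate_map_delta_closed[OF gate_mapI]

lemma delta_closedE:
  assumes "delta_closed \<delta> m A" obtains p where "gate_map \<delta> m A p"
proof -
  have "\<forall>x\<in>mspace m. \<exists>g. is_gate m A x g"
    using assms by (simp add: delta_closed_iff)
  then obtain p where "\<forall>x\<in>mspace m. is_gate m A x (p x)"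
    by (auto dest: bchoice)
  then have "gate_map \<delta> m A p"
    using assms unfolding gate_map_def delta_closed_iff by blast
  then show ?thesis by (rule that)
qed

lemma gate_map_gate: "gate_map \<delta> m A p \<Longrightarrow> x \<in> mspace m \<Longrightarrow> is_gate m A x (p x)"
  by (simp add: gate_map_def)

lemma gate_map_in: "gate_map \<delta> m A p \<Longrightarrow> x \<in> mspace m \<Longrightarrow> p x \<in> A"
  by (rule is_gate_in[OF gate_map_gate])

lemma gate_map_dist:
  "gate_map \<delta> m A p \<Longrightarrow> x \<in> mspace m \<Longrightarrow> a \<in> A \<Longrightarrow> mdist m x a = mdist m x (p x) + mdist m (p x) a"
  by (rule is_gate_dist[OF gate_map_gate])

lemma gate_map_far:
  "gate_map \<delta> m A p \<Longrightarrow> x \<in> mspace m \<Longrightarrow> y \<in> mspace m \<Longrightarrow> \<delta> < mdist m (p x) (p y) \<Longrightarrow>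
     mdist m x y = mdist m x (p x) + mdist m (p x) (p y) + mdist m (p y) y"
  unfolding gate_map_def by blast

lemma gate_map_fix:
  assumes "gate_map \<delta> m A p" "x \<in> A" shows "p x = x"
  using assms is_gate_unique[of A m x "p x" x] is_gate_self[of A m x]
  unfolding gate_map_def by blast

lemma delta_closed_mspace: "mspace m \<noteq> {} \<Longrightarrow> delta_closed \<delta> m (mspace m)"
  by (rule delta_closedI[where p = "\<lambda>x. x"]) (auto simp: is_gate_self)

text \<open>All gates coincide, and the sign of \<delta> keeps their distance 0 from passing the
  threshold. Singletons later serve as the common base of two spaces that share nothing yet.\<close>

lemma delta_closed_singleton:
  assumes "0 \<le> \<delta>" "x \<in> mspace m" shows "delta_closed \<delta> m {x}"
  by (rule delta_closedI[where p = "\<lambda>_. x"]) (use assms in \<open>auto intro: is_gateI\<close>)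

lemma delta_closed_submetric:
  assumes "delta_closed \<delta> m A" "A \<subseteq> B"
  shows "delta_closed \<delta> (submetric m B) A"
  using assms unfolding delta_closed_iff by auto

text \<open>Both the transitivity and the intersection property come from composing gate maps.\<close>

lemma delta_closed_compose:
  assumes A: "delta_closed \<delta> (submetric m B) A" and B: "delta_closed \<delta> m B"
  shows "delta_closed \<delta> m A"
proof -
  obtain q where q: "gate_map \<delta> m B q" using B by (rule delta_closedE)
  obtain p where p: "gate_map \<delta> (submetric m B) A p" using A by (rule delta_closedE)
  have Bsub: "B \<subseteq> mspace m" using B by (rule delta_closed_subset)
  then have BM: "mspace (submetric m B) = B" by auto
  have AB: "A \<subseteq> B" using delta_closed_subset[OF A] by simp
  note qin = gate_map_in[OF q] and qdist = gate_map_dist[OF q]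
  note pin = gate_map_in[OF p, unfolded BM]
    and pdist = gate_map_dist[OF p, unfolded BM mdist_submetric]
  have step: "mdist m x a = mdist m x (p (q x)) + mdist m (p (q x)) a"
    if "x \<in> mspace m" "a \<in> A" for x a
    using qdist[of x a] qdist[of x "p (q x)"] pdist[of "q x" a] that qin[of x] pin[of "q x"] AB
    by fastforce
  show ?thesis
  proof (rule delta_closedI)
    show "A \<noteq> {}" "A \<subseteq> mspace m" using A AB Bsub by (auto simp: delta_closed_iff)
    show "is_gate m A x (p (q x))" if "x \<in> mspace m" for x
      using that step pin qin by (intro is_gateI) blast+
    show "mdist m x y = mdist m x (p (q x)) + mdist m (p (q x)) (p (q y)) + mdist m (p (q y)) y"
      if xy: "x \<in> mspace m" "y \<in> mspace m" and d: "\<delta> < mdist m (p (q x)) (p (q y))" for x y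
    proof -
      have B: "q x \<in> B" "q y \<in> B" "p (q x) \<in> B" "p (q y) \<in> B"
        using xy pin qin AB by blast+
      have 1: "mdist m (q x) (q y) =
          mdist m (q x) (p (q x)) + mdist m (p (q x)) (p (q y)) + mdist m (p (q y)) (q y)"
        using gate_map_far[OF p, unfolded BM mdist_submetric, OF B(1,2) d] .
      \<comment> \<open>The distance between the intermediate gates is a sum containing the given
        one, so it passes the threshold too and the far clause of \<open>B\<close> applies.\<close>
      then have "\<delta> < mdist m (q x) (q y)"
        using d mdist_nonneg[of m "q x" "p (q x)"] mdist_nonneg[of m "p (q y)" "q y"] by linarith
      then have "mdist m x y = mdist m x (q x) + mdist m (q x) (q y) + mdist m (q y) y"
        by (rule gate_map_far[OF q xy])
      moreover have "mdist m x (p (q x)) = mdist m x (q x) + mdist m (q x) (p (q x))"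
        "mdist m y (p (q y)) = mdist m y (q y) + mdist m (q y) (p (q y))"
        using qdist xy B by blast+
      ultimately show ?thesis
        using 1 mdist_commute[of m "p (q y)" "q y"] mdist_commute[of m "p (q y)" y]
          mdist_commute[of m "q y" y] by linarith
    qed
  qed
qed

text \<open>The distance from \<open>b\<close> to \<open>z\<close> is additive through
  \<open>g\<close>. Since \<open>h\<close> lies metrically between \<open>g\<close> and each of
  \<open>b\<close> and \<open>z\<close>, going through \<open>h\<close> would save twice
  \<open>mdist m g h\<close>, so this must be 0. Consequently, for closed sets that meet, the gate
  map of \<open>A\<close> sends \<open>B\<close> into itself.\<close>

lemma gate_in_Int:
  assumes sub: "A \<subseteq> mspace m" "B \<subseteq> mspace m" and z: "z \<in> A" "z \<in> B"
    and b: "b \<in> B" and g: "is_gate m A b g" and h: "is_gate m B g h"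
  shows "g \<in> A \<inter> B"
proof -
  have gA: "g \<in> A" and hB: "h \<in> B" using g h by (auto dest: is_gate_in)
  have "mdist m b z = mdist m b g + mdist m g z"
    "mdist m g z = mdist m g h + mdist m h z" "mdist m g b = mdist m g h + mdist m h b"
    by (fact is_gate_dist[OF g z(1)] is_gate_dist[OF h z(2)] is_gate_dist[OF h b])+
  moreover have "mdist m b z \<le> mdist m b h + mdist m h z"
    by (rule mdist_triangle) (use sub z b hB in auto)
  ultimately have "mdist m g h = 0"
    using mdist_nonneg[of m g h] mdist_commute[of m b g] mdist_commute[of m b h] by linarith
  then have "g = h" using mdist_zero gA hB sub by (metis subsetD)
  then show ?thesis using gA hB by simp
qed

lemma delta_closed_Int:
  assumes A: "delta_closed \<delta> m A" and B: "delta_closed \<delta> m B" and ne: "A \<inter> B \<noteq> {}"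
  shows "delta_closed \<delta> m (A \<inter> B)"
proof (rule delta_closed_compose[OF _ B])
  have sub: "A \<subseteq> mspace m" "B \<subseteq> mspace m"
    using A B by (auto dest: delta_closed_subset)
  obtain z where z: "z \<in> A" "z \<in> B" using ne by blast
  obtain p where p: "gate_map \<delta> m A p" using A by (rule delta_closedE)
  have pB: "p x \<in> A \<inter> B" if "x \<in> B" for x
  proof -
    have "x \<in> mspace m" "p x \<in> mspace m" using that sub gate_map_in[OF p, of x] by blast+
    moreover obtain h where "is_gate m B (p x) h"
      using B \<open>p x \<in> mspace m\<close> unfolding delta_closed_iff by blast
    ultimately show ?thesis
      using gate_in_Int[OF sub z that gate_map_gate[OF p]] by blast
  qed
  \<comment> \<open>The gate map of \<open>A\<close>, restricted to \<open>B\<close>, retracts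
    \<open>B\<close> onto the intersection.\<close>
  show "delta_closed \<delta> (submetric m B) (A \<inter> B)"
  proof (rule delta_closedI[where p = p])
    have B': "x \<in> B \<and> x \<in> mspace m" if "x \<in> mspace (submetric m B)" for x
      using that by simp
    show "is_gate (submetric m B) (A \<inter> B) x (p x)" if "x \<in> mspace (submetric m B)" for x
    proof -
      have "x \<in> B" "x \<in> mspace m" using B'[OF that] by auto
      then show ?thesis
        unfolding is_gate_submetric by (metis gate_map_gate[OF p] pB is_gate_mono inf_le1)
    qed
    show "mdist (submetric m B) x y = mdist (submetric m B) x (p x) +
        mdist (submetric m B) (p x) (p y) + mdist (submetric m B) (p y) y"
      if "x \<in> mspace (submetric m B)" "y \<in> mspace (submetric m B)"
        "\<delta> < mdist (submetric m B) (p x) (p y)" for x y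
      using gate_map_far[OF p, of x y] B'[OF that(1)] B'[OF that(2)] that(3)
      unfolding mdist_submetric by blast
  qed (use ne sub in auto)
qed

text \<open>The family may be infinite, but each member that does not contain \<open>S\<close> cuts
  the finite set \<open>S\<close> down strictly, so finitely many binary intersections
  suffice.\<close>

lemma delta_closed_Inter:
  assumes S: "finite S" "delta_closed \<delta> m S" and F: "\<And>T. T \<in> F \<Longrightarrow> delta_closed \<delta> m T"
    and ne: "S \<inter> \<Inter>F \<noteq> {}"
  shows "delta_closed \<delta> m (S \<inter> \<Inter>F)"
  using S ne
proof (induction S rule: finite_psubset_induct)
  case (psubset S)
  show ?case
  proof (cases "S \<subseteq> \<Inter>F")
    case True
    then show ?thesis using psubset.prems by (simp add: Int_absorb2)
  next
    case False
    then obtain T where T: "T \<in> F" "S \<inter> T \<subset> S" by blast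
    have eq: "S \<inter> T \<inter> \<Inter>F = S \<inter> \<Inter>F" using T by blast
    have "delta_closed \<delta> m (S \<inter> T)"
      using delta_closed_Int[OF psubset.prems(1) F[OF T(1)]] psubset.prems(2) T(1) by blast
    then show ?thesis using psubset.IH[OF T(2)] psubset.prems(2) by (simp add: eq)
  qed
qed

text \<open>Closedness speaks of two points and their gates at a time, and the gate relation does
  not change when passing to a \<open>submetric\<close>. Any two points lie in a common stage beyond
  \<open>k\<close>, where everything can be checked.\<close>

lemma delta_closed_chain_union:
  assumes B: "incseq B" "mspace m \<subseteq> (\<Union>n. B n)"
    and A: "A \<subseteq> mspace m" "\<And>n. n \<ge> k \<Longrightarrow> delta_closed \<delta> (submetric m (B n)) A"
  shows "delta_closed \<delta> m A"
  unfolding delta_closed_iff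
proof (intro conjI ballI allI impI)
  have common: "\<exists>n\<ge>k. x \<in> B n \<and> y \<in> B n" if xy: "x \<in> mspace m" "y \<in> mspace m" for x y
  proof -
    obtain i j where "x \<in> B i" "y \<in> B j" using xy B(2) by blast
    then have "x \<in> B (max k (max i j))" "y \<in> B (max k (max i j))"
      using B(1) by (meson incseqD max.coboundedI2 max.cobounded1 max.cobounded2 subsetD)+
    then show ?thesis by (meson max.cobounded1)
  qed
  show "A \<noteq> {}" using A(2)[of k] by (auto simp: delta_closed_iff)
  show "A \<subseteq> mspace m" by (fact A(1))
  show "\<exists>g. is_gate m A x g" if "x \<in> mspace m" for x
  proof -
    obtain n where "n \<ge> k" "x \<in> B n" using common \<open>x \<in> mspace m\<close> by blast
    then have "delta_closed \<delta> (submetric m (B n)) A" "x \<in> mspace (submetric m (B n))"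
      using A(2) \<open>x \<in> mspace m\<close> by auto
    then show ?thesis unfolding delta_closed_iff is_gate_submetric by blast
  qed
  show "mdist m x y = mdist m x g + mdist m g h + mdist m h y"
    if "x \<in> mspace m" "y \<in> mspace m" "is_gate m A x g" "is_gate m A y h" "\<delta> < mdist m g h"
    for x y g h
  proof -
    obtain n where "n \<ge> k" "x \<in> B n" "y \<in> B n" using common \<open>x \<in> mspace m\<close> \<open>y \<in> mspace m\<close> by blast
    then have "delta_closed \<delta> (submetric m (B n)) A"
      "x \<in> mspace (submetric m (B n))" "y \<in> mspace (submetric m (B n))"
      using A(2) that by auto
    then show ?thesis
      using that unfolding delta_closed_iff is_gate_submetric mdist_submetric by blast
  qed
qed

section \<open>Isometries\<close>

lemma isometryI:
  assumes "f ` mspace m = mspace m'"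
    and d: "\<And>x y. x \<in> mspace m \<Longrightarrow> y \<in> mspace m \<Longrightarrow> mdist m' (f x) (f y) = mdist m x y"
  shows "isometry m m' f"
proof -
  have "inj_on f (mspace m)"
  proof (rule inj_onI)
    fix x y assume "x \<in> mspace m" "y \<in> mspace m" "f x = f y"
    moreover have "f y \<in> mspace m'" using calculation(2) assms(1) by blast
    ultimately show "x = y" using d[of x y] by simp
  qed
  then show ?thesis using assms by (auto simp: isometry_def bij_betw_def)
qed

lemma isometry_image: "isometry m m' f \<Longrightarrow> f ` mspace m = mspace m'"
  by (simp add: isometry_def bij_betw_def)

lemma isometry_inj: "isometry m m' f \<Longrightarrow> inj_on f (mspace m)"
  by (simp add: isometry_def bij_betw_def)

lemma isometry_dist:
  "isometry m m' f \<Longrightarrow> x \<in> mspace m \<Longrightarrow> y \<in> mspace m \<Longrightarrow> mdist m' (f x) (f y) = mdist m x y"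
  by (simp add: isometry_def)

lemma isometry_inv:
  assumes f: "isometry m m' f" shows "isometry m' m (inv_into (mspace m) f)"
proof (rule isometryI)
  let ?i = "inv_into (mspace m) f"
  show "?i ` mspace m' = mspace m"
    using f unfolding isometry_def by (blast dest: bij_betw_inv_into bij_betw_imp_surj_on)
  show "mdist m (?i x) (?i y) = mdist m' x y" if "x \<in> mspace m'" "y \<in> mspace m'" for x y
  proof -
    have "x \<in> f ` mspace m" "y \<in> f ` mspace m" using that isometry_image[OF f] by auto
    then show ?thesis
      using isometry_dist[OF f, of "?i x" "?i y"] by (simp add: inv_into_into f_inv_into_f)
  qed
qed

lemma isometry_hyperbolic:
  assumes f: "isometry m m' f" and "hyperbolic \<delta> m" shows "hyperbolic \<delta> m'"
  unfolding hyperbolic_def isometry_image[OF f, symmetric] ball_simps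
  using assms(2) unfolding hyperbolic_def by (simp add: isometry_dist[OF f])

lemma isometry_rational:
  assumes f: "isometry m m' f" and "rational_distances m" shows "rational_distances m'"
  unfolding rational_distances_def isometry_image[OF f, symmetric] ball_simps
  using assms(2) unfolding rational_distances_def by (simp add: isometry_dist[OF f])

lemma isometry_delta_closed:
  assumes f: "isometry m m' f" and A: "delta_closed \<delta> m A"
  shows "delta_closed \<delta> m' (f ` A)"
proof -
  have im: "mspace m' = f ` mspace m" and inj: "inj_on f (mspace m)"
    and d: "\<And>x y. x \<in> mspace m \<Longrightarrow> y \<in> mspace m \<Longrightarrow> mdist m' (f x) (f y) = mdist m x y"
    using f by (auto simp: isometry_def bij_betw_def)
  have sub: "A \<subseteq> mspace m" using A by (simp add: delta_closed_iff)
  have gate: "is_gate m' (f ` A) (f x) (f g) \<longleftrightarrow> is_gate m A x g"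
    if "x \<in> mspace m" "g \<in> mspace m" for x g
  proof -
    have "f g \<in> f ` A \<longleftrightarrow> g \<in> A" using inj_on_image_mem_iff[OF inj that(2) sub] .
    moreover have "mdist m' (f x) (f a) = mdist m x a \<and> mdist m' (f g) (f a) = mdist m g a \<and>
        mdist m' (f x) (f g) = mdist m x g" if "a \<in> A" for a
      using d sub that \<open>x \<in> mspace m\<close> \<open>g \<in> mspace m\<close> by blast
    ultimately show ?thesis
      unfolding is_gate_def ball_simps by (intro conj_cong ball_cong refl) (simp_all only:)
  qed
  obtain p where p: "gate_map \<delta> m A p" using A by (rule delta_closedE)
  have pm: "p x \<in> mspace m" if "x \<in> mspace m" for x using gate_map_in[OF p that] sub by blast
  let ?i = "inv_into (mspace m) f"
  have i: "?i (f x) = x" if "x \<in> mspace m" for x using inj that by simp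
  show ?thesis
  proof (rule delta_closedI[where p = "\<lambda>y. f (p (?i y))"])
    show "is_gate m' (f ` A) x (f (p (?i x)))" if x: "x \<in> mspace m'" for x
    proof -
      obtain y where "y \<in> mspace m" "x = f y" using x im by auto
      then show ?thesis using gate gate_map_gate[OF p] pm i by auto
    qed
    show "mdist m' x y = mdist m' x (f (p (?i x))) + mdist m' (f (p (?i x))) (f (p (?i y))) +
        mdist m' (f (p (?i y))) y"
      if xy: "x \<in> mspace m'" "y \<in> mspace m'"
        and far: "\<delta> < mdist m' (f (p (?i x))) (f (p (?i y)))" for x y
    proof -
      obtain u v where "u \<in> mspace m" "x = f u" "v \<in> mspace m" "y = f v" using xy im by auto
      then show ?thesis using far gate_map_far[OF p, of u v] by (simp add: d pm i)
    qed
  qed (use A sub im in \<open>auto simp: delta_closed_iff\<close>)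
qed

lemma isometry_delta_closed_bij:
  assumes f: "isometry m m' f"
  shows "bij_betw ((`) f) {S. delta_closed \<delta> m S} {S. delta_closed \<delta> m' S}"
proof (rule bij_betw_byWitness[where f' = "\<lambda>S. inv_into (mspace m) f ` S"])
  show "\<forall>S\<in>{S. delta_closed \<delta> m S}. inv_into (mspace m) f ` f ` S = S"
    using isometry_inj[OF f] by (simp add: inv_into_image_cancel delta_closed_subset)
  show "\<forall>S\<in>{S. delta_closed \<delta> m' S}. f ` inv_into (mspace m) f ` S = S"
    by (simp add: image_inv_into_cancel[OF isometry_image[OF f]] delta_closed_subset)
qed (use isometry_delta_closed[OF f] isometry_delta_closed[OF isometry_inv[OF f]] in auto)

text \<open>A \<open>metric\<close> may take various values off its carrier, so a finite space on
  \<open>nat\<close> has uncountably many representatives. Prescribing 0 there selects one of them,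
  as the later counting argument requires.\<close>

lemma pushforward_metric:
  fixes m :: "'a metric" and f :: "'a \<Rightarrow> 'b"
  assumes inj: "inj_on f (mspace m)"
  shows "\<exists>m'. isometry m m' f \<and> (\<forall>x y. x \<notin> mspace m' \<or> y \<notin> mspace m' \<longrightarrow> mdist m' x y = 0)"
proof -
  let ?i = "inv_into (mspace m) f" and ?M = "f ` mspace m"
  let ?d = "\<lambda>x y. if x \<in> ?M \<and> y \<in> ?M then mdist m (?i x) (?i y) else 0"
  have M: "Metric_space ?M ?d"
    by unfold_locales (auto simp: inj mdist_commute mdist_triangle inj_on_eq_iff[OF inj])
  have "isometry m (metric (?M, ?d)) f"
    by (rule isometryI)
      (auto simp: Metric_space.mspace_metric[OF M] Metric_space.mdist_metric[OF M] inj)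
  then show ?thesis
    by (intro exI[of _ "metric (?M, ?d)"] conjI)
      (auto simp: Metric_space.mspace_metric[OF M] Metric_space.mdist_metric[OF M])
qed

section \<open>Gluing along a closed subspace\<close>

text \<open>Back to the original form: in an amalgam the points outside one side all lie in the
  other, where the distance is that of a single factor.\<close>

lemma delta_closed_outsideI:
  assumes "A \<noteq> {}" and sub: "A \<subseteq> mspace m"
    and p: "\<And>x. x \<in> mspace m - A \<Longrightarrow> is_gate m A x (p x)"
    and far: "\<And>x y. x \<in> mspace m - A \<Longrightarrow> y \<in> mspace m - A \<Longrightarrow> \<delta> < mdist m (p x) (p y) \<Longrightarrow>
      mdist m x y = mdist m x (p x) + mdist m (p x) (p y) + mdist m (p y) y"
  shows "delta_closed \<delta> m A"
proof -
  have "gate m A x = p x" if "x \<in> mspace m - A" for x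
    by (rule gate_eq[OF sub p[OF that]])
  moreover have "gated m A" using sub p unfolding gated_def by blast
  ultimately show ?thesis
    using assms(1) far unfolding delta_closed_def by simp
qed

section \<open>The four-point inequality in a glued space\<close>

definition four_point :: "real \<Rightarrow> 'a metric \<Rightarrow> 'a \<Rightarrow> 'a \<Rightarrow> 'a \<Rightarrow> 'a \<Rightarrow> bool" where
  "four_point \<delta> m x y z w \<longleftrightarrow>
     mdist m x y + mdist m z w \<le> max (mdist m x z + mdist m y w) (mdist m x w + mdist m y z) + 2 * \<delta> \<and>
     mdist m x z + mdist m y w \<le> max (mdist m x y + mdist m z w) (mdist m x w + mdist m y z) + 2 * \<delta> \<and>
     mdist m x w + mdist m y z \<le> max (mdist m x y + mdist m z w) (mdist m x z + mdist m y w) + 2 * \<delta>"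

lemma hyperbolic_four_point:
  "hyperbolic \<delta> m \<longleftrightarrow>
     (\<forall>x\<in>mspace m. \<forall>y\<in>mspace m. \<forall>z\<in>mspace m. \<forall>w\<in>mspace m. four_point \<delta> m x y z w)"
proof
  assume h: "hyperbolic \<delta> m"
  show "\<forall>x\<in>mspace m. \<forall>y\<in>mspace m. \<forall>z\<in>mspace m. \<forall>w\<in>mspace m. four_point \<delta> m x y z w"
  proof (intro ballI)
    fix x y z w assume "x \<in> mspace m" "y \<in> mspace m" "z \<in> mspace m" "w \<in> mspace m"
    then show "four_point \<delta> m x y z w"
      using h[unfolded hyperbolic_def, rule_format, of x y z w]
        h[unfolded hyperbolic_def, rule_format, of x y w z]
        h[unfolded hyperbolic_def, rule_format, of x z w y]
      unfolding four_point_def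
      by (simp add: mdist_commute[of m z y] mdist_commute[of m w y] mdist_commute[of m w z] add_ac max.commute)
  qed
qed (auto simp: hyperbolic_def four_point_def)

text \<open>\<open>four_point\<close> collects the inequality for all three pairings, which makes it
  invariant under permutations of the points. The three adjacent transpositions generate them
  all.\<close>

lemma four_point_swap:
  "four_point \<delta> m y x z w \<longleftrightarrow> four_point \<delta> m x y z w"
  "four_point \<delta> m x z y w \<longleftrightarrow> four_point \<delta> m x y z w"
  "four_point \<delta> m x y w z \<longleftrightarrow> four_point \<delta> m x y z w"
  unfolding four_point_def
  by (auto simp: mdist_commute[of m z y] mdist_commute[of m w y] mdist_commute[of m w z]
      mdist_commute[of m y x] mdist_commute[of m z x] mdist_commute[of m w x] add_ac max.commute)

text \<open>Replacing a point by its gate changes all three sums by the same amount.\<close>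

lemma four_point_gate:
  assumes "hyperbolic \<delta> (submetric m A)" "A \<subseteq> mspace m" "x \<in> A" "y \<in> A" "z \<in> A" "is_gate m A w g"
  shows "four_point \<delta> m x y z w"
proof -
  have "g \<in> A" using assms by (blast dest: is_gate_in)
  then have "four_point \<delta> (submetric m A) x y z g"
    using assms(1-5) unfolding hyperbolic_four_point mspace_submetric by blast
  then show ?thesis
    unfolding four_point_def mdist_submetric mdist_commute[of m _ w]
    using is_gate_dist[OF assms(6) \<open>x \<in> A\<close>] is_gate_dist[OF assms(6) \<open>y \<in> A\<close>]
      is_gate_dist[OF assms(6) \<open>z \<in> A\<close>] mdist_commute[of m g]
    by (smt (verit))
qed

text \<open>By \<open>gate_in_Int\<close> the gate of \<open>b\<close> in \<open>A\<close> already
  lies in the intersection and is therefore \<open>p b\<close>. So every crossing from one side to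
  the other passes through both gates.\<close>

lemma glue_dist:
  assumes A: "delta_closed \<delta> m A" and B: "delta_closed \<delta> m B"
    and p: "gate_map \<delta> m (A \<inter> B) p" and a: "a \<in> A" and b: "b \<in> B"
  shows "mdist m a b = mdist m a (p b) + mdist m (p b) b"
    and "mdist m a b = mdist m a (p a) + mdist m (p a) (p b) + mdist m (p b) b"
proof -
  have sub: "A \<subseteq> mspace m" "B \<subseteq> mspace m"
    using A B by (auto dest: delta_closed_subset)
  have am: "a \<in> mspace m" and bm: "b \<in> mspace m" using a b sub by auto
  have pab: "p a \<in> A \<inter> B" "p b \<in> A \<inter> B" using gate_map_in[OF p] am bm by blast+
  obtain g where g: "is_gate m A b g" using delta_closed_gate[OF A bm] by blast
  then have "g \<in> mspace m" using is_gate_in[OF g] sub(1) by (rule_tac subsetD)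
  then obtain h where h: "is_gate m B g h" using delta_closed_gate[OF B] by blast
  have "g \<in> A \<inter> B"
    using gate_in_Int[OF sub _ _ b g h] pab(1) by blast
  then have "is_gate m (A \<inter> B) b g" using is_gate_mono[OF g] by blast
  then have "g = p b"
    using is_gate_unique[of "A \<inter> B" m b] gate_map_gate[OF p bm] sub by blast
  then have "mdist m b a = mdist m b (p b) + mdist m (p b) a"
    using is_gate_dist[OF g a] by simp
  then show 1: "mdist m a b = mdist m a (p b) + mdist m (p b) b"
    by (simp add: mdist_commute)
  show "mdist m a b = mdist m a (p a) + mdist m (p a) (p b) + mdist m (p b) b"
    using 1 gate_map_dist[OF p am pab(2)] by linarith
qed

text \<open>Let H be the sum of the distances of the four points to their gates. If the gates are
  close on both sides, the sum pairing \<open>x\<close> with \<open>y\<close> is at most H + 2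
  \<delta>, the two crossing sums are at least H, and these two differ by at most twice
  \<open>mdist m (p x) (p y)\<close>. If the gates are far apart on one side, that side can be
  collapsed to its gates.\<close>

lemma four_point_glue:
  assumes A: "delta_closed \<delta> m A" "hyperbolic \<delta> (submetric m A)"
    and B: "delta_closed \<delta> m B" "hyperbolic \<delta> (submetric m B)"
    and ne: "A \<inter> B \<noteq> {}" and x: "x \<in> A" "y \<in> A" "z \<in> B" "w \<in> B"
  shows "four_point \<delta> m x y z w"
proof -
  have "delta_closed \<delta> m (A \<inter> B)" by (rule delta_closed_Int[OF A(1) B(1) ne])
  then obtain p where p: "gate_map \<delta> m (A \<inter> B) p" by (rule delta_closedE)
  note d1 = glue_dist(1)[OF A(1) B(1) p] and d2 = glue_dist(2)[OF A(1) B(1) p]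
  have sub: "A \<subseteq> mspace m" "B \<subseteq> mspace m"
    using A B by (auto dest: delta_closed_subset)
  have xm: "x \<in> mspace m" "y \<in> mspace m" "z \<in> mspace m" "w \<in> mspace m" using x sub by auto
  have P: "p x \<in> A \<inter> B" "p y \<in> A \<inter> B" "p z \<in> A \<inter> B" "p w \<in> A \<inter> B"
    using gate_map_in[OF p] xm by blast+
  have Pm: "p x \<in> mspace m" "p y \<in> mspace m" "p z \<in> mspace m" "p w \<in> mspace m"
    using P sub by auto
  consider "\<delta> < mdist m (p z) (p w)" | "\<delta> < mdist m (p x) (p y)"
    | "mdist m (p z) (p w) \<le> \<delta>" "mdist m (p x) (p y) \<le> \<delta>" by linarith
  then show ?thesis
  proof cases
    case 1
    \<comment> \<open>Returning from the gates to \<open>z\<close> and \<open>w\<close> adds the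
      same amount to all three sums, namely the distances of \<open>z\<close> and \<open>w\<close>
      to their gates.\<close>
    have "four_point \<delta> (submetric m A) x y (p z) (p w)"
      using A(2) x P sub unfolding hyperbolic_four_point mspace_submetric by blast
    moreover have "mdist m z w = mdist m (p z) z + mdist m (p z) (p w) + mdist m (p w) w"
      using gate_map_far[OF p xm(3,4) 1] by (simp add: mdist_commute)
    ultimately show ?thesis
      unfolding four_point_def mdist_submetric
      using d1[OF x(1,3)] d1[OF x(1,4)] d1[OF x(2,3)] d1[OF x(2,4)] by (smt (verit))
  next
    case 2
    have "four_point \<delta> (submetric m B) (p x) (p y) z w"
      using B(2) x P sub unfolding hyperbolic_four_point mspace_submetric by blast
    moreover have "mdist m x y = mdist m x (p x) + mdist m (p x) (p y) + mdist m y (p y)"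
      using gate_map_far[OF p xm(1,2) 2] by (simp add: mdist_commute)
    \<comment> \<open>The roles of the sides are exchanged to split a crossing distance at the gate
      of the point in \<open>A\<close>.\<close>
    moreover have "mdist m a b = mdist m a (p a) + mdist m (p a) b" if "a \<in> A" "b \<in> B" for a b
      using glue_dist(1)[OF B(1) A(1) p[unfolded Int_commute[of A]] that(2,1)]
        mdist_commute[of m b a] mdist_commute[of m b "p a"] mdist_commute[of m "p a" a] by linarith
    note this[OF x(1,3)] this[OF x(1,4)] this[OF x(2,3)] this[OF x(2,4)]
    ultimately show ?thesis
      unfolding four_point_def mdist_submetric by (smt (verit))
  next
    case 3
    have "mdist m x y \<le> mdist m x (p x) + mdist m (p x) (p y) + mdist m y (p y)"
      using mdist_triangle[OF xm(1) Pm(1) xm(2)] mdist_triangle[OF Pm(1,2) xm(2)]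
        mdist_commute[of m y "p y"] by linarith
    moreover have "mdist m z w \<le> mdist m (p z) z + mdist m (p z) (p w) + mdist m (p w) w"
      using mdist_triangle[OF xm(3) Pm(3) xm(4)] mdist_triangle[OF Pm(3,4) xm(4)]
        mdist_commute[of m z "p z"] by linarith
    moreover note d2[OF x(1,3)] d2[OF x(1,4)] d2[OF x(2,3)] d2[OF x(2,4)]
      mdist_triangle[OF Pm(1,2,3)] mdist_triangle[OF Pm(1,2,4)]
      mdist_triangle[OF Pm(2,1,3)] mdist_triangle[OF Pm(2,1,4)]
      mdist_commute[of m "p y" "p x"]
    moreover have "0 \<le> mdist m (p x) (p z)" "0 \<le> mdist m (p y) (p w)" by simp_all
    ultimately show ?thesis
      unfolding four_point_def le_max_iff_disj max_add_distrib_left using 3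
      by argo
  qed
qed

lemma hyperbolic_glue:
  assumes A: "delta_closed \<delta> m A" "hyperbolic \<delta> (submetric m A)"
    and B: "delta_closed \<delta> m B" "hyperbolic \<delta> (submetric m B)"
    and ne: "A \<inter> B \<noteq> {}" and AB: "mspace m = A \<union> B"
  shows "hyperbolic \<delta> m"
proof -
  have three: "four_point \<delta> m x y z w"
    if "delta_closed \<delta> m C" "hyperbolic \<delta> (submetric m C)" "x \<in> C" "y \<in> C" "z \<in> C" "w \<in> mspace m"
    for C x y z w
  proof -
    have "\<exists>g. is_gate m C w g" by (rule delta_closed_gate[OF that(1,6)])
    then show ?thesis
      using four_point_gate[OF that(2) delta_closed_subset[OF that(1)] that(3-5)] by blast
  qed
  note glue = four_point_glue[OF A B ne]
  show ?thesis
    unfolding hyperbolic_four_point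
  proof (intro ballI)
    fix x y z w assume xm: "x \<in> mspace m" "y \<in> mspace m" "z \<in> mspace m" "w \<in> mspace m"
    \<comment> \<open>Either three points share a side (eight cases), and the fourth is replaced by
      its gate there, or each side holds two of them (six cases).\<close>
    consider "x \<in> A" "y \<in> A" "z \<in> A" | "x \<in> A" "y \<in> A" "w \<in> A" | "x \<in> A" "z \<in> A" "w \<in> A"
      | "y \<in> A" "z \<in> A" "w \<in> A" | "x \<in> B" "y \<in> B" "z \<in> B" | "x \<in> B" "y \<in> B" "w \<in> B"
      | "x \<in> B" "z \<in> B" "w \<in> B" | "y \<in> B" "z \<in> B" "w \<in> B"
      | "x \<in> A" "y \<in> A" "z \<in> B" "w \<in> B" | "x \<in> A" "z \<in> A" "y \<in> B" "w \<in> B"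
      | "x \<in> A" "w \<in> A" "z \<in> B" "y \<in> B" | "x \<in> B" "y \<in> B" "z \<in> A" "w \<in> A"
      | "x \<in> B" "z \<in> B" "y \<in> A" "w \<in> A" | "x \<in> B" "w \<in> B" "z \<in> A" "y \<in> A"
      using xm unfolding AB Un_iff by argo
    then show "four_point \<delta> m x y z w"
    proof cases
      case 1 then show ?thesis using three[OF A] xm by blast
    next
      case 2 then show ?thesis using three[OF A] xm four_point_swap by metis
    next
      case 3 then show ?thesis using three[OF A] xm four_point_swap by metis
    next
      case 4 then show ?thesis using three[OF A] xm four_point_swap by metis
    next
      case 5 then show ?thesis using three[OF B] xm by blast
    next
      case 6 then show ?thesis using three[OF B] xm four_point_swap by metis
    next
      case 7 then show ?thesis using three[OF B] xm four_point_swap by metis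
    next
      case 8 then show ?thesis using three[OF B] xm four_point_swap by metis
    next
      case 9 then show ?thesis using glue by blast
    next
      case 10 then show ?thesis using glue[of x z y w] four_point_swap by metis
    next
      case 11 then show ?thesis using glue[of x w z y] four_point_swap by metis
    next
      case 12 then show ?thesis using glue[of z w x y] four_point_swap by metis
    next
      case 13 then show ?thesis using glue[of y w x z] four_point_swap by metis
    next
      case 14 then show ?thesis using glue[of z y x w] four_point_swap by metis
    qed
  qed
qed

lemma rational_glue:
  assumes A: "delta_closed \<delta> m A" "rational_distances (submetric m A)"
    and B: "delta_closed \<delta> m B" "rational_distances (submetric m B)"
    and ne: "A \<inter> B \<noteq> {}" and AB: "mspace m = A \<union> B"
  shows "rational_distances m"
proof -
  have "delta_closed \<delta> m (A \<inter> B)" by (rule delta_closed_Int[OF A(1) B(1) ne])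
  then obtain p where p: "gate_map \<delta> m (A \<inter> B) p" by (rule delta_closedE)
  have rA: "mdist m x y \<in> \<rat>" if "x \<in> A" "y \<in> A" for x y
    using A(2) that AB by (simp add: rational_distances_def)
  have rB: "mdist m x y \<in> \<rat>" if "x \<in> B" "y \<in> B" for x y
    using B(2) that AB by (simp add: rational_distances_def)
  have mixed: "mdist m x y \<in> \<rat>" if "x \<in> A" "y \<in> B" for x y
    using glue_dist(1)[OF A(1) B(1) p that] rA[of x "p y"] rB[of "p y" y] gate_map_in[OF p, of y]
      that AB by (metis IntE Rats_add UnCI)
  then have "mdist m x y \<in> \<rat>" if "x \<in> B" "y \<in> A" for x y
    using that by (metis mdist_commute)
  then show ?thesis using rA rB mixed unfolding rational_distances_def AB by blast
qed

section \<open>The free amalgam of two metrics over a common closed part\<close>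

lemma metric_of_Metric_space:
  assumes "Metric_space M d" shows "\<exists>m. mspace m = M \<and> mdist m = d"
  using Metric_space.mspace_metric[OF assms] Metric_space.mdist_metric[OF assms] by blast

lemma isometry_id_submetric:
  assumes eq: "\<And>x y. x \<in> mspace m \<Longrightarrow> y \<in> mspace m \<Longrightarrow> mdist m' x y = mdist m x y"
    and sub: "mspace m \<subseteq> mspace m'"
  shows "isometry m (submetric m' (mspace m)) id"
  by (rule isometryI) (use assms in auto)

text \<open>The union of the carriers is used as it stands, so an overlap of exactly the right size
  has to be arranged beforehand by renaming. In the construction \<open>r\<close> is the height of a
  point above the common part and \<open>U\<close> the length of the route through both gates:
  crossing distances equal \<open>U\<close>, all others are at most \<open>U\<close>.\<close>

lemma free_amalgam:
  fixes m1 m2 :: "'a metric"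
  defines "A \<equiv> mspace m1" and "B \<equiv> mspace m2"
  assumes cl1: "delta_closed \<delta> m1 (A \<inter> B)" and cl2: "delta_closed \<delta> m2 (A \<inter> B)"
    and agree: "\<And>x y. x \<in> A \<inter> B \<Longrightarrow> y \<in> A \<inter> B \<Longrightarrow> mdist m1 x y = mdist m2 x y"
  obtains m where "mspace m = A \<union> B"
    "\<And>x y. x \<in> A \<Longrightarrow> y \<in> A \<Longrightarrow> mdist m x y = mdist m1 x y"
    "\<And>x y. x \<in> B \<Longrightarrow> y \<in> B \<Longrightarrow> mdist m x y = mdist m2 x y"
    "delta_closed \<delta> m A" "delta_closed \<delta> m B"
proof -
  obtain p1 where p1: "gate_map \<delta> m1 (A \<inter> B) p1" using cl1 by (rule delta_closedE)
  obtain p2 where p2: "gate_map \<delta> m2 (A \<inter> B) p2" using cl2 by (rule delta_closedE)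
  \<comment> \<open>Both gate maps fix the intersection, so \<open>p\<close> restricts to
    \<open>p1\<close> on \<open>A\<close> and to \<open>p2\<close> on \<open>B\<close>.\<close>
  define p where "p x = (if x \<in> A then p1 x else p2 x)" for x
  define r where "r x = (if x \<in> A then mdist m1 x (p x) else mdist m2 x (p x))" for x
  define U where "U x y = r x + mdist m1 (p x) (p y) + r y" for x y
  \<comment> \<open>The metrics agree on the common part, so \<open>m1\<close> serves in
    \<open>U\<close> for both sides. The value 0 off the union keeps \<open>D\<close> symmetric and
    nonnegative everywhere, as \<open>Metric_space\<close> demands.\<close>
  define D where "D x y = (if x \<in> A \<and> y \<in> A then mdist m1 x y
      else if x \<in> B \<and> y \<in> B then mdist m2 x y
      else if x \<in> A \<union> B \<and> y \<in> A \<union> B then U x y else 0)" for x y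
  have pA: "p x = p1 x" if "x \<in> A" for x using that by (simp add: p_def)
  have pS: "p x = x" if "x \<in> A \<inter> B" for x
    using gate_map_fix[OF p1 that] that by (simp add: p_def)
  have pB: "p x = p2 x" if "x \<in> B" for x
    using gate_map_fix[OF p1, of x] gate_map_fix[OF p2, of x] that by (simp add: p_def)
  have pin: "p x \<in> A \<inter> B" if "x \<in> A \<union> B" for x
    using that gate_map_in[OF p1, of x] gate_map_in[OF p2, of x] pA[of x] pB[of x]
    unfolding A_def B_def by auto
  have rS: "r x = 0" if "x \<in> A \<inter> B" for x
    using that by (simp add: r_def pS A_def)
  have rA: "r x = mdist m1 x (p x)" if "x \<in> A" for x using that by (simp add: r_def)
  have rB: "r x = mdist m2 x (p x)" if "x \<in> B" for x
    using that rS[of x] pS[of x] by (auto simp: r_def B_def)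
  have r0: "0 \<le> r x" for x by (simp add: r_def)
  have DA: "D x y = mdist m1 x y" if "x \<in> A" "y \<in> A" for x y using that by (simp add: D_def)
  have DB: "D x y = mdist m2 x y" if "x \<in> B" "y \<in> B" for x y
    using that agree by (simp add: D_def)
  have gA: "mdist m1 x s = r x + mdist m1 (p x) s" if "x \<in> A" "s \<in> A \<inter> B" for x s
    using gate_map_dist[OF p1, of x s] that rA[of x] pA[of x] by (simp add: A_def)
  have gB: "mdist m2 x s = r x + mdist m1 (p x) s" if "x \<in> B" "s \<in> A \<inter> B" for x s
    using gate_map_dist[OF p2, of x s] that rB[of x] pB[of x] agree[of "p x" s] pin[of x]
    by (simp add: B_def)
  have DU: "D x y = U x y" if "x \<in> A" "y \<in> B" for x y
  proof -
    consider "y \<in> A" | "x \<in> B" | "y \<notin> A" "x \<notin> B" by blast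
    then show ?thesis
    proof cases
      case 1
      then show ?thesis using that gA[of x y] pS[of y] rS[of y] by (simp add: DA U_def)
    next
      case 2
      then have "mdist m2 x y = mdist m2 y x" "mdist m1 (p y) x = mdist m1 x (p y)"
        by (simp_all add: mdist_commute)
      then show ?thesis using that 2 gB[of y x] pS[of x] rS[of x] by (simp add: DB U_def)
    next
      case 3
      then show ?thesis using that by (simp add: D_def)
    qed
  qed
  have Dsym: "D x y = D y x" for x y
    by (simp add: D_def U_def mdist_commute[of m1 y x] mdist_commute[of m2 y x]
        mdist_commute[of m1 "p y" "p x"])
  have Usym: "U x y = U y x" for x y
    by (simp add: U_def mdist_commute[of m1 "p y" "p x"])
  have DU': "D x y = U x y" if "x \<in> B" "y \<in> A" for x y
    using DU[OF that(2,1)] Dsym[of x y] Usym[of x y] by simp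
  have leU: "D x y \<le> U x y" if "x \<in> A \<union> B" "y \<in> A \<union> B" for x y
  proof -
    have S: "p x \<in> A \<inter> B" "p y \<in> A \<inter> B" using pin that by auto
    consider "x \<in> A" "y \<in> A" | "x \<in> B" "y \<in> B" | "x \<in> A" "y \<in> B" | "x \<in> B" "y \<in> A"
      using \<open>x \<in> A \<union> B\<close> \<open>y \<in> A \<union> B\<close> by blast
    then show ?thesis
    proof cases
      case 1
      have "mdist m1 x y \<le> mdist m1 x (p y) + mdist m1 (p y) y"
        by (rule mdist_triangle) (use 1 S in \<open>auto simp: A_def\<close>)
      then show ?thesis
        using gA[of x "p y"] rA[of y] 1 S by (simp add: DA U_def mdist_commute[of m1 y])
    next
      case 2
      have "mdist m2 x y \<le> mdist m2 x (p y) + mdist m2 (p y) y"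
        by (rule mdist_triangle) (use 2 S in \<open>auto simp: B_def\<close>)
      then show ?thesis
        using gB[of x "p y"] rB[of y] 2 S by (simp add: DB U_def mdist_commute[of m2 y])
    qed (simp_all add: DU DU')
  qed
  \<comment> \<open>On a single side this is the triangle inequality for the detour from
    \<open>x\<close> via \<open>y\<close> to the gate of \<open>y\<close>, with the direct distance
    written through the gate of \<open>x\<close>.\<close>
  have key: "r x + mdist m1 (p x) (p y) \<le> D x y + r y" if "x \<in> A \<union> B" "y \<in> A \<union> B" for x y
  proof -
    have S: "p x \<in> A \<inter> B" "p y \<in> A \<inter> B" using pin that by auto
    consider "x \<in> A" "y \<in> A" | "x \<in> B" "y \<in> B" | "x \<in> A" "y \<in> B" | "x \<in> B" "y \<in> A"
      using \<open>x \<in> A \<union> B\<close> \<open>y \<in> A \<union> B\<close> by blast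
    then show ?thesis
    proof cases
      case 1
      have "mdist m1 x (p y) \<le> mdist m1 x y + mdist m1 y (p y)"
        by (rule mdist_triangle) (use 1 S in \<open>auto simp: A_def\<close>)
      then show ?thesis
        using gA[of x "p y"] rA[of y] 1 S by (simp add: DA)
    next
      case 2
      have "mdist m2 x (p y) \<le> mdist m2 x y + mdist m2 y (p y)"
        by (rule mdist_triangle) (use 2 S in \<open>auto simp: B_def\<close>)
      then show ?thesis
        using gB[of x "p y"] rB[of y] 2 S by (simp add: DB)
    next
      case 3
      then show ?thesis using r0[of y] by (simp add: DU U_def)
    next
      case 4
      then show ?thesis using r0[of y] by (simp add: DU' U_def)
    qed
  qed
  have key': "mdist m1 (p x) (p y) + r y \<le> r x + D x y" if "x \<in> A \<union> B" "y \<in> A \<union> B" for x y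
    using key[OF that(2,1)] Dsym[of x y] mdist_commute[of m1 "p x" "p y"] by linarith
  have ptri: "mdist m1 (p x) (p z) \<le> mdist m1 (p x) (p y) + mdist m1 (p y) (p z)"
    if "x \<in> A \<union> B" "y \<in> A \<union> B" "z \<in> A \<union> B" for x y z
    by (rule mdist_triangle) (use pin that in \<open>auto simp: A_def\<close>)
  have D0: "0 \<le> D x y" for x y
    using r0 by (simp add: D_def U_def)
  have tri: "D x z \<le> D x y + D y z" if M: "x \<in> A \<union> B" "y \<in> A \<union> B" "z \<in> A \<union> B" for x y z
  proof -
    \<comment> \<open>Unless the three points share a side, one of the two legs crosses and has
      length \<open>U\<close>. That leg already passes through the gate of \<open>y\<close>, and
      \<open>key\<close> or \<open>key'\<close> replaces the other leg by a route from
      there.\<close>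
    consider "x \<in> A" "y \<in> A" "z \<in> A" | "x \<in> B" "y \<in> B" "z \<in> B" | "D x y = U x y" | "D y z = U y z"
      using M DU DU' by blast
    then show ?thesis
    proof cases
      case 1
      then show ?thesis
        using mdist_triangle[of x m1 y z] by (simp add: DA A_def)
    next
      case 2
      then show ?thesis
        using mdist_triangle[of x m2 y z] by (simp add: DB B_def)
    next
      case 3
      then show ?thesis
        using leU[OF M(1,3)] key'[OF M(2,3)] ptri[OF M] by (simp add: U_def)
    next
      case 4
      then show ?thesis
        using leU[OF M(1,3)] key[OF M(1,2)] ptri[OF M] by (simp add: U_def)
    qed
  qed
  have zero: "D x y = 0 \<longleftrightarrow> x = y" if M: "x \<in> A \<union> B" "y \<in> A \<union> B" for x y
  proof -
    \<comment> \<open>A point off \<open>B\<close> has positive height, and every crossing distance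
      includes it.\<close>
    have sep: "D x y \<noteq> 0 \<and> x \<noteq> y" if "x \<in> A" "y \<in> B" "x \<notin> B" for x y
    proof -
      have "p x \<in> B" "p x \<in> A" using pin[of x] that by auto
      then have "r x \<noteq> 0" using that rA[of x] by (auto simp: A_def)
      then have "0 < U x y"
        using r0[of x] r0[of y] mdist_nonneg[of m1 "p x" "p y"] unfolding U_def by linarith
      then show ?thesis using DU[OF that(1,2)] that by auto
    qed
    consider "x \<in> A" "y \<in> A" | "x \<in> B" "y \<in> B" | "x \<in> A" "y \<in> B" "x \<notin> B"
      | "y \<in> A" "x \<in> B" "y \<notin> B"
      using M by blast
    then show ?thesis
    proof cases
      case 1 then show ?thesis by (simp add: DA A_def)
    next
      case 2 then show ?thesis by (simp add: DB B_def)
    next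
      case 3 then show ?thesis using sep[of x y] by blast
    next
      case 4 then show ?thesis using sep[of y x] Dsym[of x y] by auto
    qed
  qed
  have "Metric_space (A \<union> B) D"
    by unfold_locales (use D0 Dsym zero tri in blast)+
  then obtain m where m: "mspace m = A \<union> B" "mdist m = D"
    using metric_of_Metric_space by blast
  show ?thesis
  proof (rule that[OF m(1)])
    show "mdist m x y = mdist m1 x y" if "x \<in> A" "y \<in> A" for x y using that by (simp add: m DA)
    show "mdist m x y = mdist m2 x y" if "x \<in> B" "y \<in> B" for x y using that by (simp add: m DB)
    have gate: "D x y = D x (p x) + D (p x) y" if "x \<in> A \<and> y \<in> B \<or> x \<in> B \<and> y \<in> A" for x y
    proof -
      have "p x \<in> A \<inter> B" using that pin by blast
      then show ?thesis
        using that DU[of x y] DU'[of x y] DU[of x "p x"] DU'[of x "p x"] DU[of "p x" y]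
          DU'[of "p x" y] pS[of "p x"] rS[of "p x"]
        by (auto simp: U_def A_def)
    qed
    have "A \<inter> B \<noteq> {}" using cl1 by (rule delta_closed_nonempty)
    \<comment> \<open>Points outside \<open>A\<close> lie in \<open>B\<close>, so the far clause for
      \<open>A\<close> is that of the common part in \<open>m2\<close>: closedness of the base in
      one factor makes the other factor closed in the amalgam.\<close>
    show "delta_closed \<delta> m A"
    proof (rule delta_closed_outsideI)
      show "is_gate m A x (p x)" if "x \<in> mspace m - A" for x
        by (rule is_gateI) (use pin gate that in \<open>auto simp: m\<close>)
      show "mdist m x y = mdist m x (p x) + mdist m (p x) (p y) + mdist m (p y) y"
        if "x \<in> mspace m - A" "y \<in> mspace m - A" "\<delta> < mdist m (p x) (p y)" for x y
      proof -
        have B: "x \<in> B" "y \<in> B" "p x \<in> B" "p y \<in> B" using that pin m(1) by auto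
        then show ?thesis
          using gate_map_far[OF p2, of x y] that(3) by (simp add: m DB pB B_def)
      qed
    qed (use \<open>A \<inter> B \<noteq> {}\<close> m in auto)
    show "delta_closed \<delta> m B"
    proof (rule delta_closed_outsideI)
      show "is_gate m B x (p x)" if "x \<in> mspace m - B" for x
        by (rule is_gateI) (use pin gate that in \<open>auto simp: m\<close>)
      show "mdist m x y = mdist m x (p x) + mdist m (p x) (p y) + mdist m (p y) y"
        if "x \<in> mspace m - B" "y \<in> mspace m - B" "\<delta> < mdist m (p x) (p y)" for x y
      proof -
        have A: "x \<in> A" "y \<in> A" "p x \<in> A" "p y \<in> A" using that pin m(1) by auto
        then show ?thesis
          using gate_map_far[OF p1, of x y] that(3) by (simp add: m DA pA A_def)
      qed
    qed (use \<open>A \<inter> B \<noteq> {}\<close> m in auto)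
  qed
qed

section \<open>Closed embeddings\<close>

text \<open>The metric shadow of \<open>marked_embedding\<close>. Transitivity takes care of the
  marks: closed subsets of the source have closed images.\<close>

definition closed_embedding :: "real \<Rightarrow> 'a metric \<Rightarrow> 'b metric \<Rightarrow> ('a \<Rightarrow> 'b) \<Rightarrow> bool" where
  "closed_embedding \<delta> m m' f \<longleftrightarrow>
     (\<forall>x\<in>mspace m. \<forall>y\<in>mspace m. mdist m' (f x) (f y) = mdist m x y) \<and>
     delta_closed \<delta> m' (f ` mspace m)"

lemma closed_embedding_dist:
  "closed_embedding \<delta> m m' f \<Longrightarrow> x \<in> mspace m \<Longrightarrow> y \<in> mspace m \<Longrightarrow> mdist m' (f x) (f y) = mdist m x y"
  by (simp add: closed_embedding_def)

lemma closed_embedding_closed: "closed_embedding \<delta> m m' f \<Longrightarrow> delta_closed \<delta> m' (f ` mspace m)"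
  by (simp add: closed_embedding_def)

lemma closed_embedding_subset: "closed_embedding \<delta> m m' f \<Longrightarrow> f ` mspace m \<subseteq> mspace m'"
  by (rule delta_closed_subset[OF closed_embedding_closed])

lemma closed_embedding_isometry:
  assumes "closed_embedding \<delta> m m' f"
  shows "isometry m (submetric m' (f ` mspace m)) f"
proof (rule isometryI)
  show "f ` mspace m = mspace (submetric m' (f ` mspace m))"
    using closed_embedding_subset[OF assms] by auto
qed (simp add: closed_embedding_dist[OF assms])

lemma closed_embedding_delta_closed:
  assumes "closed_embedding \<delta> m m' f" "delta_closed \<delta> m S"
  shows "delta_closed \<delta> m' (f ` S)"
  by (rule delta_closed_compose[OF isometry_delta_closed[OF closed_embedding_isometry[OF assms(1)]
          assms(2)] closed_embedding_closed[OF assms(1)]])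

lemma closed_embedding_comp:
  assumes f: "closed_embedding \<delta> m m' f" and g: "closed_embedding \<delta> m' m'' g"
  shows "closed_embedding \<delta> m m'' (g \<circ> f)"
proof -
  have "f x \<in> mspace m'" if "x \<in> mspace m" for x
    using closed_embedding_subset[OF f] that by blast
  moreover have "delta_closed \<delta> m'' (g ` f ` mspace m)"
    by (rule closed_embedding_delta_closed[OF g closed_embedding_closed[OF f]])
  ultimately show ?thesis
    unfolding closed_embedding_def
    by (simp add: image_comp closed_embedding_dist[OF f] closed_embedding_dist[OF g])
qed

lemma isometry_closed_embedding:
  assumes f: "isometry m m' f" and "mspace m \<noteq> {}"
  shows "closed_embedding \<delta> m m' f"
  using assms delta_closed_mspace[of m'] isometry_image[OF f]
  by (auto simp: closed_embedding_def isometry_dist[OF f])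

lemma closed_embedding_id_restrict:
  assumes e: "closed_embedding \<delta> m m' id" and S: "delta_closed \<delta> m' S" "S \<subseteq> mspace m"
  shows "delta_closed \<delta> m S"
proof -
  have "isometry (submetric m' (mspace m)) m id"
    by (rule isometryI)
      (use closed_embedding_subset[OF e] closed_embedding_dist[OF e] in auto)
  then show ?thesis
    using isometry_delta_closed[OF _ delta_closed_submetric[OF S]] by fastforce
qed

section \<open>Amalgamation of finite hyperbolic spaces\<close>

definition finite_hyperbolic :: "real \<Rightarrow> 'a metric \<Rightarrow> bool" where
  "finite_hyperbolic \<delta> m \<longleftrightarrow>
     finite (mspace m) \<and> mspace m \<noteq> {} \<and> hyperbolic \<delta> m \<and> rational_distances m"

lemma isometry_finite_hyperbolic:
  assumes f: "isometry m m' f" and "finite_hyperbolic \<delta> m" shows "finite_hyperbolic \<delta> m'"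
  using assms isometry_hyperbolic[OF f] isometry_rational[OF f]
  unfolding finite_hyperbolic_def isometry_image[OF f, symmetric] by simp

lemma dist_preserving_inj_on:
  assumes "S \<subseteq> mspace m" "e ` S \<subseteq> mspace m'"
    and "\<And>x y. x \<in> S \<Longrightarrow> y \<in> S \<Longrightarrow> mdist m' (e x) (e y) = mdist m x y"
  shows "inj_on e S"
proof -
  have "isometry (submetric m S) (submetric m' (e ` S)) e"
    by (rule isometryI) (use assms in auto)
  then show ?thesis
    using isometry_inj assms(1) by (fastforce simp: Int_absorb2)
qed

text \<open>Points of \<open>T\<close> outside \<open>S\<close> are sent to fresh values, so that
  after renaming two spaces meet in the identified part only. An infinite carrier type always has
  room for this.\<close>

lemma extend_injection:
  fixes e :: "'a \<Rightarrow> 'b"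
  assumes "finite T" "inj_on e S" "finite F" "e ` S \<subseteq> F" "infinite (UNIV :: 'b set)"
  shows "\<exists>\<phi>. inj_on \<phi> T \<and> (\<forall>x\<in>S. \<phi> x = e x) \<and> \<phi> ` (T - S) \<inter> F = {}"
proof -
  have "infinite (UNIV - F)" using assms by simp
  then obtain B where B: "finite B" "card B = card (T - S)" "B \<subseteq> UNIV - F"
    using infinite_arbitrarily_large by blast
  then obtain g where g: "bij_betw g (T - S) B"
    using finite_same_card_bij[of "T - S" B] assms(1) by auto
  define \<phi> where "\<phi> x = (if x \<in> S then e x else g x)" for x
  have gF: "g x \<notin> F" if "x \<in> T - S" for x
    using bij_betwE[OF g] B(3) that by auto
  have "inj_on \<phi> (T \<inter> S \<union> (T - S))"
    unfolding inj_on_Un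
  proof (intro conjI)
    show "inj_on \<phi> (T \<inter> S)" using assms(2) by (auto simp: \<phi>_def inj_on_def)
    show "inj_on \<phi> (T - S)" using bij_betw_imp_inj_on[OF g] by (auto simp: \<phi>_def inj_on_def)
    show "\<phi> ` (T \<inter> S - (T - S)) \<inter> \<phi> ` (T - S - T \<inter> S) = {}"
      using gF assms(4) by (fastforce simp: \<phi>_def)
  qed
  then have "inj_on \<phi> T" by (simp add: Int_Diff_Un)
  moreover have "\<phi> ` (T - S) \<inter> F = {}" using gF by (auto simp: \<phi>_def)
  ultimately show ?thesis by (intro exI[of _ \<phi>]) (simp add: \<phi>_def)
qed

text \<open>\<open>T\<close> is renamed so that it meets \<open>m\<close> exactly in the image of
  \<open>S\<close>, which is the situation of \<open>free_amalgam\<close>. Keeping \<open>m\<close>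
  in place, with \<open>id\<close> as its embedding, lets the stages of the later chain be
  increasing sets.\<close>

lemma amalgamation:
  fixes m :: "'a metric" and T :: "'b metric"
  assumes m: "finite_hyperbolic \<delta> m" and T: "finite_hyperbolic \<delta> T" and S: "delta_closed \<delta> T S"
    and e: "\<And>x y. x \<in> S \<Longrightarrow> y \<in> S \<Longrightarrow> mdist m (e x) (e y) = mdist T x y"
    and eS: "delta_closed \<delta> m (e ` S)" and inf: "infinite (UNIV :: 'a set)"
  obtains m' e' where "finite_hyperbolic \<delta> m'" "closed_embedding \<delta> m m' id"
    "closed_embedding \<delta> T m' e'" "\<And>x. x \<in> S \<Longrightarrow> e' x = e x"
proof -
  have ST: "S \<subseteq> mspace T" and eSm: "e ` S \<subseteq> mspace m"
    using S eS by (auto dest: delta_closed_subset)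
  have "inj_on e S" by (rule dist_preserving_inj_on[OF ST eSm e])
  moreover have "finite (mspace T)" "finite (mspace m)" using m T by (auto simp: finite_hyperbolic_def)
  ultimately obtain \<phi> where \<phi>: "inj_on \<phi> (mspace T)" "\<And>x. x \<in> S \<Longrightarrow> \<phi> x = e x"
      "\<phi> ` (mspace T - S) \<inter> mspace m = {}"
    using extend_injection[of "mspace T" e S "mspace m"] eSm inf by blast
  obtain T' where T': "isometry T T' \<phi>" using pushforward_metric[OF \<phi>(1)] by blast
  have T'm: "mspace T' = \<phi> ` mspace T" using isometry_image[OF T'] by simp
  have \<phi>S: "\<phi> ` S = e ` S" using \<phi>(2) by (intro image_cong) auto
  have int: "mspace m \<inter> mspace T' = e ` S"
  proof
    show "mspace m \<inter> mspace T' \<subseteq> e ` S"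
      using \<phi>(2,3) unfolding T'm by blast
    show "e ` S \<subseteq> mspace m \<inter> mspace T'"
      using eSm ST \<phi>S unfolding T'm by blast
  qed
  have cl': "delta_closed \<delta> T' (e ` S)"
    using isometry_delta_closed[OF T' S] \<phi>S by simp
  have agree: "mdist m x y = mdist T' x y" if "x \<in> e ` S" "y \<in> e ` S" for x y
  proof -
    obtain u v where uv: "u \<in> S" "v \<in> S" "x = e u" "y = e v" using \<open>x \<in> e ` S\<close> \<open>y \<in> e ` S\<close> by blast
    then have "u \<in> mspace T" "v \<in> mspace T" using ST by auto
    then show ?thesis using isometry_dist[OF T', of u v] uv e \<phi>(2) by simp
  qed
  have fhT': "finite_hyperbolic \<delta> T'" by (rule isometry_finite_hyperbolic[OF T' T])
  obtain D where D: "mspace D = mspace m \<union> mspace T'"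
    "\<And>x y. x \<in> mspace m \<Longrightarrow> y \<in> mspace m \<Longrightarrow> mdist D x y = mdist m x y"
    "\<And>x y. x \<in> mspace T' \<Longrightarrow> y \<in> mspace T' \<Longrightarrow> mdist D x y = mdist T' x y"
    "delta_closed \<delta> D (mspace m)" "delta_closed \<delta> D (mspace T')"
    using free_amalgam[of \<delta> m T', unfolded int, OF eS cl' agree] by blast
  have i1: "isometry m (submetric D (mspace m)) id"
    by (rule isometry_id_submetric) (use D in auto)
  have i2: "isometry T' (submetric D (mspace T')) id"
    by (rule isometry_id_submetric) (use D in auto)
  have ne: "mspace m \<inter> mspace T' \<noteq> {}" using int delta_closed_nonempty[OF eS] by simp
  have "hyperbolic \<delta> D"
    using hyperbolic_glue[OF D(4) _ D(5) _ ne D(1)] isometry_hyperbolic[OF i1]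
      isometry_hyperbolic[OF i2] m fhT' unfolding finite_hyperbolic_def by blast
  moreover have "rational_distances D"
    using rational_glue[OF D(4) _ D(5) _ ne D(1)] isometry_rational[OF i1]
      isometry_rational[OF i2] m fhT' unfolding finite_hyperbolic_def by blast
  ultimately have "finite_hyperbolic \<delta> D"
    using m fhT' D(1) unfolding finite_hyperbolic_def by auto
  moreover have "closed_embedding \<delta> m D id"
    unfolding closed_embedding_def using D(2,4) by simp
  moreover have "closed_embedding \<delta> T D \<phi>"
    unfolding closed_embedding_def T'm[symmetric]
    using D(3,5) T'm isometry_dist[OF T'] by simp
  ultimately show ?thesis using that \<phi>(2) by blast
qed

text \<open>A definition cannot quantify over types, so \<open>T\<close> ranges over spaces on
  \<open>nat\<close>. Every finite space has such a copy, and \<open>closed_extendingD\<close>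
  recovers the property for all types.\<close>

definition closed_extending :: "real \<Rightarrow> 'a metric \<Rightarrow> bool" where
  "closed_extending \<delta> m \<longleftrightarrow>
     (\<forall>(T :: nat metric) S e. finite_hyperbolic \<delta> T \<longrightarrow> delta_closed \<delta> T S \<longrightarrow>
        (\<forall>x\<in>S. \<forall>y\<in>S. mdist m (e x) (e y) = mdist T x y) \<longrightarrow> delta_closed \<delta> m (e ` S) \<longrightarrow>
        (\<exists>e'. closed_embedding \<delta> T m e' \<and> (\<forall>x\<in>S. e' x = e x)))"

lemma nat_copy:
  fixes T :: "'a metric"
  assumes "finite (mspace T)"
  obtains T' :: "nat metric" and \<phi> where "isometry T T' \<phi>"
proof -
  obtain \<phi> :: "'a \<Rightarrow> nat" where "inj_on \<phi> (mspace T)"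
    using finite_imp_inj_to_nat_seg[OF assms] by blast
  then show ?thesis using pushforward_metric that by blast
qed

lemma closed_extendingD:
  fixes m :: "'a metric" and T :: "'b metric"
  assumes ext: "closed_extending \<delta> m" and T: "finite_hyperbolic \<delta> T" and S: "delta_closed \<delta> T S"
    and e: "\<And>x y. x \<in> S \<Longrightarrow> y \<in> S \<Longrightarrow> mdist m (e x) (e y) = mdist T x y"
    and eS: "delta_closed \<delta> m (e ` S)"
  obtains e' where "closed_embedding \<delta> T m e'" "\<And>x. x \<in> S \<Longrightarrow> e' x = e x"
proof -
  obtain T' :: "nat metric" and \<phi> where \<phi>: "isometry T T' \<phi>"
    using nat_copy[of T] T unfolding finite_hyperbolic_def by blast
  let ?i = "inv_into (mspace T) \<phi>"
  have ST: "S \<subseteq> mspace T" using S by (rule delta_closed_subset)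
  have i: "?i (\<phi> x) = x" if "x \<in> S" for x
    using isometry_inj[OF \<phi>] ST that by auto
  have eq: "(e \<circ> ?i) ` \<phi> ` S = e ` S"
    unfolding image_comp[symmetric] inv_into_image_cancel[OF isometry_inj[OF \<phi>] ST] ..
  have "mdist m ((e \<circ> ?i) x) ((e \<circ> ?i) y) = mdist T' x y" if xy: "x \<in> \<phi> ` S" "y \<in> \<phi> ` S" for x y
  proof -
    obtain u v where uv: "u \<in> S" "v \<in> S" "x = \<phi> u" "y = \<phi> v" using xy by blast
    then have "u \<in> mspace T" "v \<in> mspace T" using ST by auto
    then show ?thesis using isometry_dist[OF \<phi>, of u v] uv e i by simp
  qed
  then obtain e' where e': "closed_embedding \<delta> T' m e'" "\<forall>x\<in>\<phi> ` S. e' x = (e \<circ> ?i) x"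
    using ext[unfolded closed_extending_def, rule_format, of T' "\<phi> ` S" "e \<circ> ?i"]
      isometry_finite_hyperbolic[OF \<phi> T] isometry_delta_closed[OF \<phi> S] eS eq by metis
  have "closed_embedding \<delta> T m (e' \<circ> \<phi>)"
    by (rule closed_embedding_comp[OF isometry_closed_embedding[OF \<phi>] e'(1)])
      (use T in \<open>simp add: finite_hyperbolic_def\<close>)
  then show ?thesis using that e'(2) i by auto
qed

section \<open>Limits of chains\<close>

definition closed_chain :: "real \<Rightarrow> 'a metric \<Rightarrow> (nat \<Rightarrow> 'a set) \<Rightarrow> bool" where
  "closed_chain \<delta> m A \<longleftrightarrow> incseq A \<and> (\<forall>n. finite (A n) \<and> delta_closed \<delta> m (A n)) \<and>
     (\<Union>n. A n) = mspace m"

lemma finite_subset_incseq: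
  assumes "incseq A" "finite S" "S \<subseteq> (\<Union>n. A n)"
  shows "\<exists>k. \<forall>n\<ge>k. S \<subseteq> A n"
  using assms(2,3)
proof (induction S rule: finite_induct)
  case (insert x S)
  obtain k l where "\<forall>n\<ge>k. S \<subseteq> A n" "x \<in> A l" using insert by auto
  moreover have "x \<in> A n" if "n \<ge> l" for n
    using \<open>x \<in> A l\<close> that assms(1) by (meson incseqD subsetD)
  ultimately have "\<forall>n\<ge>max k l. insert x S \<subseteq> A n" by auto
  then show ?case by blast
qed simp

lemma closed_chain_cover:
  assumes "closed_chain \<delta> m A" "finite S" "S \<subseteq> mspace m"
  shows "\<exists>k. \<forall>n\<ge>k. S \<subseteq> A n"
  using finite_subset_incseq[of A S] assms unfolding closed_chain_def by blast

text \<open>The direct limit of inclusions. Stages agree wherever both apply, so a distance may be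
  read off at any stage containing both points, and each metric axiom involves at most three
  points.\<close>

lemma chain_limit:
  fixes A :: "nat \<Rightarrow> 'a metric"
  assumes step: "\<And>n. closed_embedding \<delta> (A n) (A (Suc n)) id"
  shows "\<exists>m. incseq (\<lambda>n. mspace (A n)) \<and> mspace m = (\<Union>n. mspace (A n)) \<and>
    (\<forall>n. closed_embedding \<delta> (A n) m id)"
proof -
  have ne: "mspace (A n) \<noteq> {}" for n
    using delta_closed_nonempty[OF closed_embedding_closed[OF step[of n]]] by auto
  have emb: "closed_embedding \<delta> (A i) (A j) id" if "i \<le> j" for i j
    using that
  proof (induction rule: dec_induct)
    case base
    show ?case using delta_closed_mspace[OF ne] by (simp add: closed_embedding_def)
  next
    case (step n)
    then show ?case using closed_embedding_comp[OF step.IH assms[of n]] by simp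
  qed
  have mono: "incseq (\<lambda>n. mspace (A n))"
    using closed_embedding_subset[OF step] by (intro incseq_SucI) simp
  have agree: "mdist (A i) x y = mdist (A j) x y"
    if "x \<in> mspace (A i)" "y \<in> mspace (A i)" "x \<in> mspace (A j)" "y \<in> mspace (A j)" for i j x y
  proof (cases "i \<le> j")
    case True then show ?thesis using closed_embedding_dist[OF emb[OF True]] that by simp
  next
    case False
    then have "j \<le> i" by simp
    then show ?thesis using closed_embedding_dist[OF emb[OF \<open>j \<le> i\<close>]] that by simp
  qed
  define P where "P x y n \<longleftrightarrow> x \<in> mspace (A n) \<and> y \<in> mspace (A n)" for x y n
  define d where "d x y = (if \<exists>n. P x y n then mdist (A (LEAST n. P x y n)) x y else 0)" for x y
  define M where "M = (\<Union>n. mspace (A n))"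
  have d: "d x y = mdist (A n) x y" if "x \<in> mspace (A n)" "y \<in> mspace (A n)" for x y n
  proof -
    have "P x y n" using that by (simp add: P_def)
    define k where "k = (LEAST n. P x y n)"
    have "P x y k" unfolding k_def using \<open>P x y n\<close> by (rule LeastI)
    then have "mdist (A k) x y = mdist (A n) x y" using agree that unfolding P_def by blast
    moreover have "d x y = mdist (A k) x y"
      unfolding d_def k_def using \<open>P x y n\<close> by (subst if_P) auto
    ultimately show ?thesis by simp
  qed
  have common: "\<exists>n. S \<subseteq> mspace (A n)" if "finite S" "S \<subseteq> M" for S
    using finite_subset_incseq[OF mono that(1)] that(2) unfolding M_def by blast
  have "Metric_space M d"
  proof
    show "0 \<le> d x y" for x y by (simp add: d_def)
    show "d x y = d y x" for x y
    proof -
      \<comment> \<open>Equal predicates have the same least witness, so symmetry holds off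
        \<open>M\<close> as well.\<close>
      have "P x y = P y x" by (auto simp: P_def fun_eq_iff)
      then show ?thesis unfolding d_def by (simp only: mdist_commute[of _ x y])
    qed
    show "d x y = 0 \<longleftrightarrow> x = y" if "x \<in> M" "y \<in> M" for x y
    proof -
      obtain n where "{x, y} \<subseteq> mspace (A n)" using common[of "{x, y}"] \<open>x \<in> M\<close> \<open>y \<in> M\<close> by auto
      then show ?thesis by (simp add: d[where n = n])
    qed
    show "d x z \<le> d x y + d y z" if "x \<in> M" "y \<in> M" "z \<in> M" for x y z
    proof -
      obtain n where "{x, y, z} \<subseteq> mspace (A n)" using common[of "{x, y, z}"] \<open>x \<in> M\<close> \<open>y \<in> M\<close> \<open>z \<in> M\<close> by auto
      then show ?thesis by (simp add: d[where n = n] mdist_triangle)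
    qed
  qed
  then obtain m where m: "mspace m = M" "mdist m = d" using metric_of_Metric_space by blast
  have iso: "isometry (A n) (submetric m (mspace (A n))) id" for n
    by (rule isometry_id_submetric) (auto simp: m d[where n = n] M_def)
  \<comment> \<open>Each stage is closed in all later ones, and
    \<open>delta_closed_chain_union\<close> carries this to the union.\<close>
  have "delta_closed \<delta> m (mspace (A k))" for k
  proof (rule delta_closed_chain_union[OF mono])
    show "delta_closed \<delta> (submetric m (mspace (A n))) (mspace (A k))" if "n \<ge> k" for n
      using isometry_delta_closed[OF iso closed_embedding_closed[OF emb[OF that]]] by simp
  qed (auto simp: m M_def)
  then have "closed_embedding \<delta> (A n) m id" for n
    by (simp add: closed_embedding_def m d[where n = n])
  then show ?thesis using mono m(1) unfolding M_def by blast
qed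

lemma closed_chain_hyperbolic:
  assumes c: "closed_chain \<delta> m A" and h: "\<And>n. hyperbolic \<delta> (submetric m (A n))"
  shows "hyperbolic \<delta> m"
  unfolding hyperbolic_four_point
proof (intro ballI)
  fix x y z w assume xm: "x \<in> mspace m" "y \<in> mspace m" "z \<in> mspace m" "w \<in> mspace m"
  obtain n where "{x, y, z, w} \<subseteq> A n" using closed_chain_cover[OF c, of "{x, y, z, w}"] xm by auto
  then have "four_point \<delta> (submetric m (A n)) x y z w"
    using h[of n] xm unfolding hyperbolic_four_point by simp
  then show "four_point \<delta> m x y z w" by (simp add: four_point_def)
qed

lemma closed_chain_rational:
  assumes c: "closed_chain \<delta> m A" and h: "\<And>n. rational_distances (submetric m (A n))"
  shows "rational_distances m"
  unfolding rational_distances_def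
proof (intro ballI)
  fix x y assume xm: "x \<in> mspace m" "y \<in> mspace m"
  obtain n where "{x, y} \<subseteq> A n" using closed_chain_cover[OF c, of "{x, y}"] xm by auto
  then show "mdist m x y \<in> \<rat>"
    using h[of n] xm unfolding rational_distances_def by simp
qed

section \<open>Existence of the limit\<close>

definition normal_metrics :: "nat metric set" where
  "normal_metrics = {m. finite (mspace m) \<and> rational_distances m \<and>
     (\<forall>x y. x \<notin> mspace m \<or> y \<notin> mspace m \<longrightarrow> mdist m x y = 0)}"

text \<open>Such a metric can be recovered from the finite set of triples of two points and their
  distance. Rational values let the triples range over a countable type, and the zeros off the
  carrier make the recovery exact.\<close>

lemma countable_normal_metrics: "countable normal_metrics"
proof -
  define rat_of :: "real \<Rightarrow> rat" where "rat_of r = (SOME q. of_rat q = r)" for r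
  have rat_of: "of_rat (rat_of r) = r" if "r \<in> \<rat>" for r
    using that someI_ex[of "\<lambda>q. of_rat q = r"] unfolding rat_of_def by (auto simp: Rats_def)
  define code where
    "code m = (\<lambda>(x, y). (x, y, rat_of (mdist m x y))) ` (mspace m \<times> mspace m)" for m :: "nat metric"
  have "inj_on code normal_metrics"
  proof (rule inj_onI)
    fix m m' assume m: "m \<in> normal_metrics" and m': "m' \<in> normal_metrics" and eq: "code m = code m'"
    have M: "mspace k = fst ` code k" for k unfolding code_def by force
    have sp: "mspace m = mspace m'" unfolding M eq ..
    have "mdist m x y = mdist m' x y" for x y
    proof (cases "x \<in> mspace m \<and> y \<in> mspace m")
      case True
      then have "(x, y, rat_of (mdist m x y)) \<in> code m"
        unfolding code_def by force
      then have "(x, y, rat_of (mdist m x y)) \<in> code m'" by (simp only: eq)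
      then have "rat_of (mdist m x y) = rat_of (mdist m' x y)"
        unfolding code_def by auto
      moreover have "mdist m x y \<in> \<rat>" "mdist m' x y \<in> \<rat>"
        using True m m' sp unfolding normal_metrics_def rational_distances_def by auto
      ultimately show ?thesis using rat_of by metis
    next
      case False
      then have "mdist m x y = 0" "mdist m' x y = 0"
        using m m' sp unfolding normal_metrics_def by blast+
      then show ?thesis by simp
    qed
    then have "mdist m = mdist m'" by blast
    then show "m = m'" using sp metric_collapse[of m] metric_collapse[of m'] by metis
  qed
  moreover have "code ` normal_metrics \<subseteq> {F. finite F}"
    by (auto simp: code_def normal_metrics_def)
  then have "countable (code ` normal_metrics)"
    using countable_subset countable_Collect_finite by blast
  ultimately show ?thesis by (rule countable_image_inj_on[rotated])
qed

text \<open>An index \<open>i\<close> is paired with every \<open>k\<close>, and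
  \<open>prod_encode (i, k)\<close> is at least \<open>k\<close>, so each element recurs arbitrarily
  late. Recurrence matters because an extension problem may become meaningful only at a late
  stage.\<close>

lemma enumerate_infinitely_often:
  assumes "countable P" shows "\<exists>p :: nat \<Rightarrow> 'a. \<forall>c\<in>P. \<forall>k. \<exists>n\<ge>k. p n = c"
proof (intro exI[of _ "from_nat_into P \<circ> fst \<circ> prod_decode"] ballI allI)
  fix c k assume "c \<in> P"
  then obtain i where "from_nat_into P i = c" using from_nat_into_surj[OF assms(1)] by blast
  then show "\<exists>n\<ge>k. (from_nat_into P \<circ> fst \<circ> prod_decode) n = c"
    by (intro exI[of _ "prod_encode (i, k)"]) (simp add: le_prod_encode_2)
qed

text \<open>The hypotheses of an extension problem whose base embedding has been normalised to an
  inclusion. The pair of \<open>T\<close> and \<open>S\<close> then describes it, without a map into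
  a stage that is not yet built.\<close>

definition solvable :: "real \<Rightarrow> 'a metric \<Rightarrow> 'a metric \<Rightarrow> 'a set \<Rightarrow> bool" where
  "solvable \<delta> m T S \<longleftrightarrow> finite_hyperbolic \<delta> T \<and> delta_closed \<delta> T S \<and> delta_closed \<delta> m S \<and>
     (\<forall>x\<in>S. \<forall>y\<in>S. mdist m x y = mdist T x y)"

lemma solve_extension:
  fixes m T :: "nat metric"
  assumes m: "finite_hyperbolic \<delta> m"
  shows "\<exists>m'. finite_hyperbolic \<delta> m' \<and> closed_embedding \<delta> m m' id \<and>
    (solvable \<delta> m T S \<longrightarrow> (\<exists>e. closed_embedding \<delta> T m' e \<and> (\<forall>x\<in>S. e x = x)))"
proof (cases "solvable \<delta> m T S")
  case True
  then have T: "finite_hyperbolic \<delta> T" "delta_closed \<delta> T S" "delta_closed \<delta> m (id ` S)"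
    "\<And>x y. x \<in> S \<Longrightarrow> y \<in> S \<Longrightarrow> mdist m (id x) (id y) = mdist T x y"
    by (auto simp: solvable_def)
  obtain m' e where "finite_hyperbolic \<delta> m'" "closed_embedding \<delta> m m' id"
    "closed_embedding \<delta> T m' e" "\<And>x. x \<in> S \<Longrightarrow> e x = id x"
    using amalgamation[OF m T(1,2,4,3) infinite_UNIV_nat] by blast
  then show ?thesis by (metis id_apply)
next
  case False
  have "closed_embedding \<delta> m m id"
    using m delta_closed_mspace[of m] by (simp add: closed_embedding_def finite_hyperbolic_def)
  then show ?thesis using m False by blast
qed

lemma finite_hyperbolic_point:
  assumes "0 \<le> \<delta>" shows "\<exists>m :: 'a metric. mspace m = {c} \<and> finite_hyperbolic \<delta> m"
proof -
  have "Metric_space {c} (\<lambda>_ _. 0)" by unfold_locales auto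
  then obtain m where "mspace m = {c}" "mdist m = (\<lambda>_ _. 0)"
    using metric_of_Metric_space by blast
  then show ?thesis
    using assms by (auto simp: finite_hyperbolic_def hyperbolic_def rational_distances_def)
qed

lemma finite_hyperbolic_submetric:
  assumes "hyperbolic \<delta> m" "rational_distances m" "delta_closed \<delta> m A" "finite A"
  shows "finite_hyperbolic \<delta> (submetric m A)"
proof -
  have "hyperbolic \<delta> (submetric m A)" "rational_distances (submetric m A)"
    using assms(1,2) by (simp_all add: hyperbolic_def rational_distances_def)
  then show ?thesis
    using assms(4) delta_closed_subset[OF assms(3)] delta_closed_nonempty[OF assms(3)]
    by (simp add: finite_hyperbolic_def Int_absorb2)
qed

text \<open>The chain clause makes the space countable and places every finite subset inside a
  finite closed one.\<close>

definition hyperbolic_limit :: "real \<Rightarrow> 'a metric \<Rightarrow> bool" where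
  "hyperbolic_limit \<delta> m \<longleftrightarrow> hyperbolic \<delta> m \<and> rational_distances m \<and>
     (\<exists>A. closed_chain \<delta> m A) \<and> closed_extending \<delta> m"

lemma hyperbolic_limit_exists:
  assumes "0 \<le> \<delta>"
  obtains m :: "nat metric" where "hyperbolic_limit \<delta> m"
proof -
  \<comment> \<open>Many of these pairs pose no genuine problem; for them \<open>good\<close> asks
    only for a closed inclusion.\<close>
  define P where "P = normal_metrics \<times> {S :: nat set. finite S}"
  have "countable P"
    unfolding P_def by (rule countable_SIGMA[OF countable_normal_metrics countable_Collect_finite])
  then obtain p :: "nat \<Rightarrow> nat metric \<times> nat set" where p: "\<forall>c\<in>P. \<forall>k. \<exists>n\<ge>k. p n = c"
    using enumerate_infinitely_often[of P] by blast
  define good where "good m m' T S \<longleftrightarrow> closed_embedding \<delta> m m' id \<and>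
    (solvable \<delta> m T S \<longrightarrow> (\<exists>e. closed_embedding \<delta> T m' e \<and> (\<forall>x\<in>S. e x = x)))"
    for m m' T :: "nat metric" and S
  have "\<exists>A. \<forall>n. finite_hyperbolic \<delta> (A n) \<and> good (A n) (A (Suc n)) (fst (p n)) (snd (p n))"
  proof (rule dependent_nat_choice)
    show "\<exists>m :: nat metric. finite_hyperbolic \<delta> m"
      using finite_hyperbolic_point[OF assms, of 0] by blast
    show "\<exists>m'. finite_hyperbolic \<delta> m' \<and> good m m' (fst (p n)) (snd (p n))"
      if "finite_hyperbolic \<delta> m" for m n
      using solve_extension[OF that] unfolding good_def by blast
  qed
  then obtain A where A: "\<And>n. finite_hyperbolic \<delta> (A n)"
      "\<And>n. good (A n) (A (Suc n)) (fst (p n)) (snd (p n))" by blast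
  have step: "closed_embedding \<delta> (A n) (A (Suc n)) id" for n
    using A(2) by (simp add: good_def)
  obtain m where m: "incseq (\<lambda>n. mspace (A n))" "mspace m = (\<Union>n. mspace (A n))"
    "\<And>n. closed_embedding \<delta> (A n) m id"
    using chain_limit[of \<delta> A, OF step] by blast
  have chain: "closed_chain \<delta> m (\<lambda>n. mspace (A n))"
    unfolding closed_chain_def
    using m A(1) closed_embedding_closed[OF m(3)] by (simp add: finite_hyperbolic_def)
  have iso: "isometry (A n) (submetric m (mspace (A n))) id" for n
    using closed_embedding_isometry[OF m(3)] by simp
  have "hyperbolic \<delta> m"
    by (rule closed_chain_hyperbolic[OF chain isometry_hyperbolic[OF iso]])
      (use A(1) in \<open>simp add: finite_hyperbolic_def\<close>)
  moreover have "rational_distances m"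
    by (rule closed_chain_rational[OF chain isometry_rational[OF iso]])
      (use A(1) in \<open>simp add: finite_hyperbolic_def\<close>)
  moreover have "closed_extending \<delta> m"
    unfolding closed_extending_def
  proof (intro allI impI)
    fix T :: "nat metric" and S e
    assume T: "finite_hyperbolic \<delta> T" and S: "delta_closed \<delta> T S"
      and e: "\<forall>x\<in>S. \<forall>y\<in>S. mdist m (e x) (e y) = mdist T x y" and eS: "delta_closed \<delta> m (e ` S)"
    have ST: "S \<subseteq> mspace T" and eSm: "e ` S \<subseteq> mspace m"
      using S eS by (auto dest: delta_closed_subset)
    have finS: "finite (e ` S)" using ST T by (auto simp: finite_hyperbolic_def finite_subset)
    have "inj_on e S" by (rule dist_preserving_inj_on[OF ST eSm]) (use e in blast)
    moreover have "finite (mspace T)" using T by (simp add: finite_hyperbolic_def)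
    \<comment> \<open>Renaming \<open>T\<close> along \<open>e\<close> turns the base embedding into
      an inclusion, so the problem occurs in the enumerated set.\<close>
    ultimately obtain \<phi> where \<phi>: "inj_on \<phi> (mspace T)" "\<And>x. x \<in> S \<Longrightarrow> \<phi> x = e x"
      using extend_injection[OF _ _ finS subset_refl infinite_UNIV_nat, of "mspace T"] by blast
    obtain T' where T': "isometry T T' \<phi>"
        "\<forall>x y. x \<notin> mspace T' \<or> y \<notin> mspace T' \<longrightarrow> mdist T' x y = 0"
      using pushforward_metric[OF \<phi>(1)] by blast
    have fhT': "finite_hyperbolic \<delta> T'" by (rule isometry_finite_hyperbolic[OF T'(1) T])
    have "T' \<in> normal_metrics"
      using fhT' T'(2) unfolding normal_metrics_def finite_hyperbolic_def by blast
    then have "(T', e ` S) \<in> P" using finS by (simp add: P_def)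
    obtain k where k: "\<And>n. n \<ge> k \<Longrightarrow> e ` S \<subseteq> mspace (A n)"
      using closed_chain_cover[OF chain finS eSm] by blast
    \<comment> \<open>An occurrence late enough for the finite base to have entered the chain: the
      problem is solvable at stage \<open>n\<close> and solved at \<open>Suc n\<close>.\<close>
    obtain n where n: "n \<ge> k" "p n = (T', e ` S)" using p \<open>(T', e ` S) \<in> P\<close> by blast
    have \<phi>S: "\<phi> ` S = e ` S" using \<phi>(2) by (intro image_cong) auto
    have "solvable \<delta> (A n) T' (e ` S)"
      unfolding solvable_def
    proof (intro conjI ballI)
      show "delta_closed \<delta> T' (e ` S)" using isometry_delta_closed[OF T'(1) S] \<phi>S by simp
      show "delta_closed \<delta> (A n) (e ` S)"
        by (rule closed_embedding_id_restrict[OF m(3) eS k[OF n(1)]])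
      fix x y assume xy: "x \<in> e ` S" "y \<in> e ` S"
      then obtain u v where uv: "u \<in> S" "v \<in> S" "x = e u" "y = e v" by blast
      have "mdist m x y = mdist (A n) x y"
        using closed_embedding_dist[OF m(3), of x n y] k[OF n(1)] xy by auto
      moreover have "mdist T' x y = mdist T u v"
        using isometry_dist[OF T'(1), of u v] uv \<phi>(2) ST by auto
      ultimately show "mdist (A n) x y = mdist T' x y" using e uv by simp
    qed (fact fhT')
    then obtain f where f: "closed_embedding \<delta> T' (A (Suc n)) f" "\<forall>x\<in>e ` S. f x = x"
      using A(2)[of n] n(2) unfolding good_def by auto
    have "closed_embedding \<delta> T T' \<phi>"
      by (rule isometry_closed_embedding[OF T'(1)]) (use T in \<open>simp add: finite_hyperbolic_def\<close>)
    then have "closed_embedding \<delta> T m (id \<circ> (f \<circ> \<phi>))"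
      by (rule closed_embedding_comp[OF closed_embedding_comp[OF _ f(1)] m(3)])
    moreover have "(id \<circ> (f \<circ> \<phi>)) x = e x" if "x \<in> S" for x
      using \<phi>(2)[OF that] f(2) that by simp
    ultimately show "\<exists>e'. closed_embedding \<delta> T m e' \<and> (\<forall>x\<in>S. e' x = e x)" by blast
  qed
  ultimately show ?thesis using that chain unfolding hyperbolic_limit_def by blast
qed

section \<open>Back and forth\<close>

text \<open>A relation instead of a function: its converse is of the same kind, so the back step is
  the forth step read backwards. That it is single-valued and injective follows from preservation of
  distances.\<close>

definition partial_isometry ::
  "real \<Rightarrow> 'a metric \<Rightarrow> 'b metric \<Rightarrow> ('a \<times> 'b) set \<Rightarrow> bool" where
  "partial_isometry \<delta> m m' R \<longleftrightarrow>
     finite R \<and> delta_closed \<delta> m (Domain R) \<and> delta_closed \<delta> m' (Range R) \<and>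
     (\<forall>x y x' y'. (x, y) \<in> R \<longrightarrow> (x', y') \<in> R \<longrightarrow> mdist m' y y' = mdist m x x')"

lemma partial_isometry_converse:
  "partial_isometry \<delta> m m' R \<Longrightarrow> partial_isometry \<delta> m' m (R\<inverse>)"
  by (simp add: partial_isometry_def)

lemma partial_isometry_dist:
  "partial_isometry \<delta> m m' R \<Longrightarrow> (x, y) \<in> R \<Longrightarrow> (x', y') \<in> R \<Longrightarrow> mdist m' y y' = mdist m x x'"
  unfolding partial_isometry_def by blast

lemma partial_isometry_mspace:
  assumes "partial_isometry \<delta> m m' R" "(x, y) \<in> R" shows "x \<in> mspace m" "y \<in> mspace m'"
proof -
  have "Domain R \<subseteq> mspace m" "Range R \<subseteq> mspace m'"
    using assms(1) delta_closed_subset unfolding partial_isometry_def by blast+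
  then show "x \<in> mspace m" "y \<in> mspace m'" using assms(2) by blast+
qed

lemma partial_isometry_graph:
  assumes C: "finite C" "delta_closed \<delta> m C" and fC: "delta_closed \<delta> m' (f ` C)"
    and d: "\<And>x y. x \<in> C \<Longrightarrow> y \<in> C \<Longrightarrow> mdist m' (f x) (f y) = mdist m x y"
  shows "partial_isometry \<delta> m m' ((\<lambda>x. (x, f x)) ` C)"
proof -
  have "Domain ((\<lambda>x. (x, f x)) ` C) = C" "Range ((\<lambda>x. (x, f x)) ` C) = f ` C" by force+
  then show ?thesis using assms unfolding partial_isometry_def by auto
qed

text \<open>The subspace on \<open>C\<close> is a finite hyperbolic space in which the old domain is
  closed, hence an extension problem for \<open>m'\<close>.\<close>

lemma partial_isometry_forth:
  assumes m: "hyperbolic \<delta> m" "rational_distances m" and ext: "closed_extending \<delta> m'"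
    and R: "partial_isometry \<delta> m m' R"
    and C: "finite C" "delta_closed \<delta> m C" "Domain R \<subseteq> C"
  shows "\<exists>R'. R \<subseteq> R' \<and> partial_isometry \<delta> m m' R' \<and> C \<subseteq> Domain R'"
proof -
  define f where "f x = (SOME y. (x, y) \<in> R)" for x
  have f: "f x = y" if "(x, y) \<in> R" for x y
  proof -
    have fx: "(x, f x) \<in> R" unfolding f_def using that by (rule someI)
    have "mdist m' (f x) y = 0"
      using partial_isometry_dist[OF R fx that] partial_isometry_mspace[OF R that] by simp
    then show ?thesis
      using partial_isometry_mspace[OF R that] partial_isometry_mspace[OF R fx] by simp
  qed
  have fR: "(x, f x) \<in> R" if "x \<in> Domain R" for x using f that by blast
  have ran: "Range R = f ` Domain R" using f fR by blast
  let ?T = "submetric m C"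
  have CM: "mspace ?T = C" using delta_closed_subset[OF C(2)] by auto
  have S: "delta_closed \<delta> ?T (Domain R)"
    by (rule delta_closed_submetric[OF _ C(3)]) (use R in \<open>simp add: partial_isometry_def\<close>)
  have d: "mdist m' (f x) (f y) = mdist ?T x y" if "x \<in> Domain R" "y \<in> Domain R" for x y
    using partial_isometry_dist[OF R fR[OF that(1)] fR[OF that(2)]] by simp
  have fS: "delta_closed \<delta> m' (f ` Domain R)"
    using R unfolding partial_isometry_def ran by blast
  obtain e where e: "closed_embedding \<delta> ?T m' e" "\<And>x. x \<in> Domain R \<Longrightarrow> e x = f x"
    using closed_extendingD[OF ext finite_hyperbolic_submetric[OF m C(2,1)] S d fS] by blast
  have "partial_isometry \<delta> m m' ((\<lambda>x. (x, e x)) ` C)"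
    using closed_embedding_dist[OF e(1)] closed_embedding_closed[OF e(1)] C(1,2)
    unfolding CM mdist_submetric by (intro partial_isometry_graph) auto
  moreover have "R \<subseteq> (\<lambda>x. (x, e x)) ` C"
  proof
    fix z assume z: "z \<in> R"
    obtain x y where xy: "z = (x, y)" by (cases z)
    then have "x \<in> C" "e x = y" using z e(2)[of x] f[of x y] C(3) by auto
    then show "z \<in> (\<lambda>x. (x, e x)) ` C" using xy by auto
  qed
  ultimately show ?thesis by (intro exI[of _ "(\<lambda>x. (x, e x)) ` C"]) auto
qed

text \<open>A finite set need not be closed, but domains have to stay closed. The chain supplies a
  finite closed set around \<open>F\<close> and the old domain.\<close>

lemma partial_isometry_cover:
  assumes m: "hyperbolic_limit \<delta> m" and ext: "closed_extending \<delta> m'"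
    and R: "partial_isometry \<delta> m m' R" and F: "finite F" "F \<subseteq> mspace m"
  shows "\<exists>R'. R \<subseteq> R' \<and> partial_isometry \<delta> m m' R' \<and> F \<subseteq> Domain R'"
proof -
  obtain A where A: "closed_chain \<delta> m A" using m by (auto simp: hyperbolic_limit_def)
  have fin: "finite (Domain R \<union> F)" and sub: "Domain R \<union> F \<subseteq> mspace m"
    using R F delta_closed_subset[of \<delta> m "Domain R"]
    by (auto simp: partial_isometry_def finite_Domain)
  obtain k where k: "\<forall>n\<ge>k. Domain R \<union> F \<subseteq> A n" using closed_chain_cover[OF A fin sub] ..
  then have DF: "Domain R \<subseteq> A k" "F \<subseteq> A k" by auto
  have "finite (A k)" "delta_closed \<delta> m (A k)" using A by (auto simp: closed_chain_def)
  moreover have "hyperbolic \<delta> m" "rational_distances m" using m by (auto simp: hyperbolic_limit_def)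
  ultimately have "\<exists>R'. R \<subseteq> R' \<and> partial_isometry \<delta> m m' R' \<and> A k \<subseteq> Domain R'"
    using partial_isometry_forth[OF _ _ ext R _ _ DF(1)] by simp
  then show ?thesis using DF(2) by (meson subset_trans)
qed

lemma back_and_forth:
  assumes m: "hyperbolic_limit \<delta> m" and m': "hyperbolic_limit \<delta> m'"
    and R: "partial_isometry \<delta> m m' R"
  shows "\<exists>h. isometry m m' h \<and> (\<forall>x y. (x, y) \<in> R \<longrightarrow> h x = y)"
proof -
  obtain A B where A: "closed_chain \<delta> m A" and B: "closed_chain \<delta> m' B"
    using m m' by (auto simp: hyperbolic_limit_def)
  have ext: "closed_extending \<delta> m" "closed_extending \<delta> m'"
    using m m' by (auto simp: hyperbolic_limit_def)
  have finA: "finite (A n)" "A n \<subseteq> mspace m" for n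
    using A by (auto simp: closed_chain_def)
  have finB: "finite (B n)" "B n \<subseteq> mspace m'" for n
    using B by (auto simp: closed_chain_def)
  \<comment> \<open>Each step absorbs the current members of both chains, so the union becomes total
    on one side and onto on the other.\<close>
  have "\<exists>f. \<forall>n. (partial_isometry \<delta> m m' (f n) \<and> R \<subseteq> f n) \<and>
      (f n \<subseteq> f (Suc n) \<and> A n \<subseteq> Domain (f (Suc n)) \<and> B n \<subseteq> Range (f (Suc n)))"
  proof (rule dependent_nat_choice)
    show "\<exists>Q. partial_isometry \<delta> m m' Q \<and> R \<subseteq> Q" using R by blast
    fix Q n assume Q: "partial_isometry \<delta> m m' Q \<and> R \<subseteq> Q"
    obtain Q1 where Q1: "Q \<subseteq> Q1" "partial_isometry \<delta> m m' Q1" "A n \<subseteq> Domain Q1"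
      using partial_isometry_cover[OF m ext(2) conjunct1[OF Q] finA[of n]] by blast
    obtain Q2 where Q2: "Q1\<inverse> \<subseteq> Q2" "partial_isometry \<delta> m' m Q2" "B n \<subseteq> Domain Q2"
      using partial_isometry_cover[OF m' ext(1) partial_isometry_converse[OF Q1(2)] finB[of n]] by blast
    have "Q1 \<subseteq> Q2\<inverse>" using Q2(1) by (simp add: converse_subset_swap)
    moreover have "A n \<subseteq> Domain (Q2\<inverse>)" using Q1(3) Domain_mono[OF \<open>Q1 \<subseteq> Q2\<inverse>\<close>] by (rule subset_trans)
    moreover have "B n \<subseteq> Range (Q2\<inverse>)" using Q2(3) by simp
    ultimately show "\<exists>Q'. (partial_isometry \<delta> m m' Q' \<and> R \<subseteq> Q') \<and>
        (Q \<subseteq> Q' \<and> A n \<subseteq> Domain Q' \<and> B n \<subseteq> Range Q')"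
      using partial_isometry_converse[OF Q2(2)] Q1(1) conjunct2[OF Q]
      by (intro exI[of _ "Q2\<inverse>"]) (simp only:, blast)
  qed
  then obtain f where f: "\<And>n. partial_isometry \<delta> m m' (f n)" "\<And>n. R \<subseteq> f n"
    "\<And>n. f n \<subseteq> f (Suc n)" "\<And>n. A n \<subseteq> Domain (f (Suc n))" "\<And>n. B n \<subseteq> Range (f (Suc n))"
    by blast
  have mono: "incseq f" using f(3) by (rule incseq_SucI)
  define U where "U = (\<Union>n. f n)"
  have UM: "x \<in> mspace m" "y \<in> mspace m'" if "(x, y) \<in> U" for x y
    using that partial_isometry_mspace[OF f(1)] unfolding U_def by blast+
  have dist: "mdist m' y y' = mdist m x x'" if xy: "(x, y) \<in> U" "(x', y') \<in> U" for x y x' y'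
  proof -
    obtain k where "{(x, y), (x', y')} \<subseteq> f k"
      using finite_subset_incseq[OF mono, of "{(x, y), (x', y')}"] xy unfolding U_def by auto
    then show ?thesis using partial_isometry_dist[OF f(1)[of k]] by blast
  qed
  define h where "h x = (SOME y. (x, y) \<in> U)" for x
  have h: "h x = y" if "(x, y) \<in> U" for x y
  proof -
    have hx: "(x, h x) \<in> U" unfolding h_def using that by (rule someI)
    have "mdist m' (h x) y = 0" using dist[OF hx that] UM[OF that] by simp
    then show ?thesis using UM[OF that] UM[OF hx] by simp
  qed
  have dom: "\<exists>y. (x, y) \<in> U" if x: "x \<in> mspace m" for x
  proof -
    obtain n where "x \<in> A n" using A x by (auto simp: closed_chain_def)
    then show ?thesis using f(4)[of n] unfolding U_def by blast
  qed
  have ran: "\<exists>x. (x, y) \<in> U" if y: "y \<in> mspace m'" for y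
  proof -
    obtain n where "y \<in> B n" using B y by (auto simp: closed_chain_def)
    then show ?thesis using f(5)[of n] unfolding U_def by blast
  qed
  have hU: "(x, h x) \<in> U" if "x \<in> mspace m" for x using dom[OF that] h by metis
  have "isometry m m' h"
  proof (rule isometryI)
    show "h ` mspace m = mspace m'"
    proof (intro equalityI subsetI)
      fix y assume "y \<in> h ` mspace m"
      then show "y \<in> mspace m'" using hU UM(2) by blast
    next
      fix y assume "y \<in> mspace m'"
      then obtain x where "(x, y) \<in> U" using ran by blast
      then show "y \<in> h ` mspace m" using h UM(1) by blast
    qed
    show "mdist m' (h x) (h y) = mdist m x y" if "x \<in> mspace m" "y \<in> mspace m" for x y
      by (rule dist[OF hU[OF that(1)] hU[OF that(2)]])
  qed
  moreover have "h x = y" if "(x, y) \<in> R" for x y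
    using h f(2)[of 0] that unfolding U_def by blast
  ultimately show ?thesis by blast
qed

section \<open>Marked spaces\<close>

text \<open>An infinite space is closed in itself, whereas the age consists of finite spaces; hence
  the finiteness clause. On finite spaces these are the marks of
  \<open>hyperbolic_class\<close>.\<close>

definition closed_marks :: "real \<Rightarrow> 'a metric \<Rightarrow> 'a set set" where
  "closed_marks \<delta> m = {S. finite S \<and> delta_closed \<delta> m S}"

lemma isometry_closed_marks:
  assumes f: "isometry m m' f"
  shows "bij_betw ((`) f) (closed_marks \<delta> m) (closed_marks \<delta> m')"
proof -
  have "bij_betw ((`) f) {S \<in> {S. delta_closed \<delta> m S}. finite S} {S \<in> {S. delta_closed \<delta> m' S}. finite S}"
  proof (rule bij_betw_Collect[OF isometry_delta_closed_bij[OF f]])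
    fix S assume "S \<in> {S. delta_closed \<delta> m S}"
    then have "inj_on f S"
      using inj_on_subset[OF isometry_inj[OF f]] delta_closed_subset by blast
    then show "finite (f ` S) = finite S" by (rule finite_image_iff)
  qed
  then show ?thesis by (simp add: closed_marks_def conj_commute)
qed

lemma marked_iso_closed_marks:
  assumes "isometry (space_of A) (space_of B) f"
    and "marks A = closed_marks \<delta> (space_of A)" "marks B = closed_marks \<delta> (space_of B)"
  shows "marked_iso A B f"
  using assms isometry_closed_marks[OF assms(1)] by (simp add: marked_iso_def)

text \<open>Transitivity makes inherited marks and intrinsic closed subsets coincide, which lets
  isomorphisms between marked subspaces be handled as isometries.\<close>

lemma closed_marks_submetric:
  assumes "delta_closed \<delta> m A"
  shows "{T \<in> closed_marks \<delta> m. T \<subseteq> A} = closed_marks \<delta> (submetric m A)"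
proof -
  have "delta_closed \<delta> m T \<and> T \<subseteq> A \<longleftrightarrow> delta_closed \<delta> (submetric m A) T" for T
    using delta_closed_compose[OF _ assms] delta_closed_submetric
      delta_closed_subset[of \<delta> "submetric m A" T] by auto
  then show ?thesis by (auto simp: closed_marks_def)
qed

lemma marks_marked_subspace:
  assumes "marks M = closed_marks \<delta> (space_of M)" "A \<in> marks M"
  shows "marks (marked_subspace M A) = closed_marks \<delta> (space_of (marked_subspace M A))"
  using assms closed_marks_submetric[of \<delta> "space_of M" A]
  by (simp add: marked_subspace_def closed_marks_def)

lemma closed_marks_finite:
  assumes "finite (mspace m)" shows "closed_marks \<delta> m = {S. delta_closed \<delta> m S}"
proof -
  have "finite S" if "delta_closed \<delta> m S" for S
    by (rule finite_subset[OF delta_closed_subset[OF that] assms])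
  then show ?thesis by (auto simp: closed_marks_def)
qed

lemma hyperbolic_class_iff:
  "A \<in> hyperbolic_class \<delta> \<longleftrightarrow>
     finite_hyperbolic \<delta> (space_of A) \<and> marks A = closed_marks \<delta> (space_of A)"
proof (cases "finite (points A)")
  case True
  show ?thesis
    unfolding hyperbolic_class_def finite_hyperbolic_def closed_marks_finite[OF True] mem_Collect_eq
    by argo
qed (simp add: hyperbolic_class_def finite_hyperbolic_def)

section \<open>From metric limits to marked limits\<close>

lemma hyperbolic_limit_point:
  assumes "hyperbolic_limit \<delta> m" shows "\<exists>x. x \<in> mspace m"
proof -
  obtain A where "closed_chain \<delta> m A" using assms by (auto simp: hyperbolic_limit_def)
  then have A: "delta_closed \<delta> m (A 0)" by (simp add: closed_chain_def)
  show ?thesis using delta_closed_nonempty[OF A] delta_closed_subset[OF A] by blast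
qed

text \<open>One point of \<open>T\<close> is sent to any point of \<open>m\<close>. Both singletons
  are closed, so the extension property yields the rest.\<close>

lemma hyperbolic_limit_universal:
  assumes "0 \<le> \<delta>" and m: "hyperbolic_limit \<delta> m" and T: "finite_hyperbolic \<delta> T"
  shows "\<exists>f. closed_embedding \<delta> T m f"
proof -
  obtain x where x: "x \<in> mspace T" using T by (auto simp: finite_hyperbolic_def)
  obtain y where y: "y \<in> mspace m" using hyperbolic_limit_point[OF m] by blast
  have ext: "closed_extending \<delta> m" using m by (simp add: hyperbolic_limit_def)
  obtain f where "closed_embedding \<delta> T m f"
    by (rule closed_extendingD[OF ext T delta_closed_singleton[OF assms(1) x], of "\<lambda>_. y"])
      (use x y delta_closed_singleton[OF assms(1) y] in auto)
  then show ?thesis by blast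
qed

lemma hyperbolic_limit_homogeneous:
  assumes m: "hyperbolic_limit \<delta> m" and S: "S \<in> closed_marks \<delta> m" and T: "T \<in> closed_marks \<delta> m"
    and f: "isometry (submetric m S) (submetric m T) f"
  shows "\<exists>h. isometry m m h \<and> (\<forall>x\<in>S. h x = f x)"
proof -
  have ST: "S \<subseteq> mspace m" "T \<subseteq> mspace m"
    using S T delta_closed_subset by (auto simp: closed_marks_def)
  have im: "f ` S = T" using isometry_image[OF f] ST by (simp add: Int_absorb2)
  have "partial_isometry \<delta> m m ((\<lambda>x. (x, f x)) ` S)"
  proof (rule partial_isometry_graph)
    show "mdist m (f x) (f y) = mdist m x y" if "x \<in> S" "y \<in> S" for x y
      using isometry_dist[OF f, of x y] that ST by auto
  qed (use S T im in \<open>auto simp: closed_marks_def\<close>)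
  then obtain h where "isometry m m h" "\<forall>x y. (x, y) \<in> (\<lambda>x. (x, f x)) ` S \<longrightarrow> h x = y"
    using back_and_forth[OF m m] by blast
  then show ?thesis by blast
qed

lemma hyperbolic_limit_marked_fraisse_limit:
  assumes \<delta>: "0 \<le> \<delta>" and m: "hyperbolic_limit \<delta> m"
  shows "marked_fraisse_limit (hyperbolic_class \<delta>) \<lparr>space_of = m, marks = closed_marks \<delta> m\<rparr>"
    (is "marked_fraisse_limit _ ?M")
proof -
  obtain A where A: "closed_chain \<delta> m A" using m by (auto simp: hyperbolic_limit_def)
  have M: "marks ?M = closed_marks \<delta> (space_of ?M)" by simp
  have h: "hyperbolic \<delta> m" "rational_distances m" "closed_extending \<delta> m"
    using m by (auto simp: hyperbolic_limit_def)
  have fin: "finite_hyperbolic \<delta> (submetric m S)" if "S \<in> closed_marks \<delta> m" for S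
    using finite_hyperbolic_submetric[OF h(1,2)] that by (simp add: closed_marks_def)
  have sub: "S \<subseteq> mspace m" if "S \<in> closed_marks \<delta> m" for S
    using that delta_closed_subset by (auto simp: closed_marks_def)
  have space: "marked_space ?M"
  proof -
    have "countable (\<Union>n. A n)"
      using A by (intro countable_UN) (auto simp: closed_chain_def countable_finite)
    then have cnt: "countable (mspace m)" using A by (simp add: closed_chain_def)
    have "closed_marks \<delta> m \<subseteq> {S. finite S \<and> S \<subseteq> mspace m}"
      using sub by (auto simp: closed_marks_def)
    then have "countable (closed_marks \<delta> m)"
      by (rule countable_subset[OF _ countable_Collect_finite_subset[OF cnt]])
    moreover have "\<Inter>F \<in> closed_marks \<delta> m" if F: "F \<subseteq> closed_marks \<delta> m" "F \<noteq> {}" "\<Inter>F \<noteq> {}" for F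
    proof -
      obtain S where S: "S \<in> F" using F by blast
      then have eq: "S \<inter> \<Inter>F = \<Inter>F" by blast
      have S': "finite S" "delta_closed \<delta> m S" using S F(1) by (auto simp: closed_marks_def)
      \<comment> \<open>A single finite member of the family bounds the whole intersection, as
        \<open>delta_closed_Inter\<close> requires.\<close>
      have "delta_closed \<delta> m (S \<inter> \<Inter>F)"
        by (rule delta_closed_Inter[OF S']) (use F eq in \<open>auto simp: closed_marks_def\<close>)
      moreover have "finite (S \<inter> \<Inter>F)" using S' by simp
      ultimately show ?thesis unfolding eq by (simp add: closed_marks_def)
    qed
    ultimately show ?thesis using sub by (auto simp: marked_space_def)
  qed
  have age: "belongs_to (marked_subspace ?M S) (hyperbolic_class \<delta>)" if S: "S \<in> marks ?M" for S
  proof -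
    have fS: "finite_hyperbolic \<delta> (submetric m S)" using fin S by simp
    \<comment> \<open>Representatives of the class live on \<open>nat\<close>, so one has to be
      produced by copying.\<close>
    then obtain T :: "nat metric" and \<phi> where \<phi>: "isometry (submetric m S) T \<phi>"
      using nat_copy[of "submetric m S"] unfolding finite_hyperbolic_def by blast
    let ?R = "\<lparr>space_of = T, marks = closed_marks \<delta> T\<rparr>"
    have "?R \<in> hyperbolic_class \<delta>"
      using isometry_finite_hyperbolic[OF \<phi> fS] by (simp add: hyperbolic_class_iff)
    moreover have "marked_iso ?R (marked_subspace ?M S) (inv_into (mspace (submetric m S)) \<phi>)"
    proof (rule marked_iso_closed_marks[OF _ _ marks_marked_subspace[OF M S]])
      show "isometry (space_of ?R) (space_of (marked_subspace ?M S))
          (inv_into (mspace (submetric m S)) \<phi>)"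
        using isometry_inv[OF \<phi>] by (simp add: marked_subspace_def)
    qed simp
    ultimately show ?thesis unfolding belongs_to_def by blast
  qed
  have cofinal: "range A \<subseteq> marks ?M \<and> incseq A \<and> (\<Union>n. A n) = points ?M"
    using A by (auto simp: closed_chain_def closed_marks_def)
  have universal: "\<exists>f. marked_embedding R ?M f" if R: "R \<in> hyperbolic_class \<delta>" for R
  proof -
    have T: "finite_hyperbolic \<delta> (space_of R)" "marks R = closed_marks \<delta> (space_of R)"
      using R by (auto simp: hyperbolic_class_iff)
    obtain f where f: "closed_embedding \<delta> (space_of R) m f"
      using hyperbolic_limit_universal[OF \<delta> m T(1)] by blast
    have mem: "f ` points R \<in> marks ?M"
      using closed_embedding_closed[OF f] T(1) by (simp add: closed_marks_def finite_hyperbolic_def)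
    have "marked_iso R (marked_subspace ?M (f ` points R)) f"
    proof (rule marked_iso_closed_marks[OF _ T(2) marks_marked_subspace[OF M mem]])
      show "isometry (space_of R) (space_of (marked_subspace ?M (f ` points R))) f"
        using closed_embedding_isometry[OF f] by (simp add: marked_subspace_def)
    qed
    then show ?thesis using mem unfolding marked_embedding_def by blast
  qed
  have homogeneous: "\<exists>h. marked_iso ?M ?M h \<and> (\<forall>x\<in>S. h x = f x)"
    if S: "S \<in> marks ?M" and T: "T \<in> marks ?M"
      and f: "marked_iso (marked_subspace ?M S) (marked_subspace ?M T) f" for S T f
  proof -
    have iso: "isometry (submetric m S) (submetric m T) f"
      using f by (simp add: marked_iso_def marked_subspace_def)
    have "S \<in> closed_marks \<delta> m" "T \<in> closed_marks \<delta> m" using S T by simp_all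
    then obtain k where k: "isometry m m k" "\<forall>x\<in>S. k x = f x"
      using hyperbolic_limit_homogeneous[OF m _ _ iso] by blast
    have "marked_iso ?M ?M k"
      by (rule marked_iso_closed_marks[OF _ M M]) (simp add: k(1))
    then show ?thesis using k(2) by blast
  qed
  show ?thesis
    unfolding marked_fraisse_limit_def
  proof (intro conjI ballI allI impI)
    show "\<exists>A. range A \<subseteq> marks ?M \<and> incseq A \<and> (\<Union>n. A n) = points ?M"
      by (rule exI[of _ A]) (rule cofinal)
  qed (rule space age universal homogeneous; assumption)+
qed

lemma marked_fraisse_limit_D:
  assumes lim: "marked_fraisse_limit (hyperbolic_class \<delta>) M"
  shows "marks M = closed_marks \<delta> (space_of M)" and "hyperbolic_limit \<delta> (space_of M)"
proof -
  let ?m = "space_of M"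
  have space: "marks M \<subseteq> Pow (mspace ?m)"
    using lim by (auto simp: marked_fraisse_limit_def marked_space_def)
  have age: "finite_hyperbolic \<delta> (submetric ?m A) \<and> finite A \<and>
      {T \<in> marks M. T \<subseteq> A} = closed_marks \<delta> (submetric ?m A)" if A: "A \<in> marks M" for A
  proof -
    obtain R f where R: "R \<in> hyperbolic_class \<delta>" and f: "marked_iso R (marked_subspace M A) f"
      using lim A unfolding marked_fraisse_limit_def belongs_to_def by blast
    have iso: "isometry (space_of R) (submetric ?m A) f"
      and bij: "bij_betw ((`) f) (marks R) {T \<in> marks M. T \<subseteq> A}"
      using f by (auto simp: marked_iso_def marked_subspace_def)
    have fh: "finite_hyperbolic \<delta> (submetric ?m A)"
      using isometry_finite_hyperbolic[OF iso] R by (simp add: hyperbolic_class_iff)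
    moreover have "finite A"
      using fh space A by (auto simp: finite_hyperbolic_def Int_absorb2)
    \<comment> \<open>Both sides are the image of the marks of \<open>R\<close> under
      \<open>f\<close>: one because \<open>f\<close> is a marked isomorphism, the other because it
      is an isometry.\<close>
    moreover have "{T \<in> marks M. T \<subseteq> A} = closed_marks \<delta> (submetric ?m A)"
      using bij_betw_imp_surj_on[OF bij] bij_betw_imp_surj_on[OF isometry_closed_marks[OF iso, of \<delta>]] R
      by (simp add: hyperbolic_class_iff)
    ultimately show ?thesis by blast
  qed
  obtain B where B: "range B \<subseteq> marks M" "incseq B" "(\<Union>n. B n) = mspace ?m"
    using lim unfolding marked_fraisse_limit_def by blast
  have Bm: "B n \<in> marks M" for n using B(1) by blast
  \<comment> \<open>The age controls a mark only inside larger marks. Here \<open>A\<close> is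
    closed in every late member of the chain, and this lifts to the whole space.\<close>
  have closed: "delta_closed \<delta> ?m A" if A: "A \<in> marks M" for A
  proof -
    have fA: "finite A" "A \<subseteq> mspace ?m" using age[OF A] space A by auto
    then have "A \<subseteq> (\<Union>n. B n)" using B(3) by simp
    from finite_subset_incseq[OF B(2) fA(1) this] obtain k where k: "\<forall>n\<ge>k. A \<subseteq> B n" ..
    have "delta_closed \<delta> (submetric ?m (B n)) A" if "n \<ge> k" for n
    proof -
      have "A \<in> {T \<in> marks M. T \<subseteq> B n}" using A k that by blast
      then show ?thesis using age[OF Bm[of n]] by (simp add: closed_marks_def)
    qed
    with B(3) show ?thesis
      by (intro delta_closed_chain_union[OF B(2) _ fA(2), of k]) simp_all
  qed
  have mark: "A \<in> marks M" if A: "finite A" "delta_closed \<delta> ?m A" for A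
  proof -
    have "A \<subseteq> (\<Union>n. B n)" using B(3) delta_closed_subset[OF A(2)] by simp
    from finite_subset_incseq[OF B(2) A(1) this] obtain k where k: "A \<subseteq> B k" by blast
    have "A \<in> closed_marks \<delta> (submetric ?m (B k))"
      using delta_closed_submetric[OF A(2) k] A(1) by (simp add: closed_marks_def)
    then show ?thesis using age[OF Bm[of k]] by blast
  qed
  show M: "marks M = closed_marks \<delta> ?m"
    unfolding closed_marks_def using closed mark age by (intro equalityI subsetI CollectI conjI) auto
  have chain: "closed_chain \<delta> ?m B"
    unfolding closed_chain_def using B(2,3) closed[OF Bm] age[OF Bm] by simp
  have "hyperbolic \<delta> ?m"
    by (rule closed_chain_hyperbolic[OF chain]) (use age[OF Bm] in \<open>simp add: finite_hyperbolic_def\<close>)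
  moreover have "rational_distances ?m"
    by (rule closed_chain_rational[OF chain]) (use age[OF Bm] in \<open>simp add: finite_hyperbolic_def\<close>)
  moreover have "closed_extending \<delta> ?m"
    unfolding closed_extending_def
  proof (intro allI impI)
    fix T :: "nat metric" and S e
    assume T: "finite_hyperbolic \<delta> T" and S: "delta_closed \<delta> T S"
      and e: "\<forall>x\<in>S. \<forall>y\<in>S. mdist ?m (e x) (e y) = mdist T x y" and eS: "delta_closed \<delta> ?m (e ` S)"
    have "\<lparr>space_of = T, marks = closed_marks \<delta> T\<rparr> \<in> hyperbolic_class \<delta>"
      using T by (simp add: hyperbolic_class_iff)
    \<comment> \<open>Universality places \<open>T\<close> somewhere; homogeneity then moves the
      image of \<open>S\<close> under \<open>f\<close> onto its image under \<open>e\<close>, and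
      \<open>h \<circ> f\<close> is the extension sought.\<close>
    then obtain f where "marked_embedding \<lparr>space_of = T, marks = closed_marks \<delta> T\<rparr> M f"
      using lim unfolding marked_fraisse_limit_def by blast
    then have fT: "f ` mspace T \<in> marks M" and iso: "isometry T (submetric ?m (f ` mspace T)) f"
      by (auto simp: marked_embedding_def marked_iso_def marked_subspace_def)
    have f: "closed_embedding \<delta> T ?m f"
      using closed[OF fT] isometry_dist[OF iso] by (simp add: closed_embedding_def)
    have ST: "S \<subseteq> mspace T" and eSm: "e ` S \<subseteq> mspace ?m"
      using S eS by (auto dest: delta_closed_subset)
    have finS: "finite S" using ST T by (auto simp: finite_hyperbolic_def finite_subset)
    have fS: "delta_closed \<delta> ?m (f ` S)" by (rule closed_embedding_delta_closed[OF f S])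
    have m1: "f ` S \<in> marks M" and m2: "e ` S \<in> marks M" using mark fS eS finS by auto
    let ?i = "inv_into (mspace T) f"
    have i: "?i (f x) = x" if "x \<in> S" for x using isometry_inj[OF iso] ST that by auto
    have fSm: "f ` S \<subseteq> mspace ?m" by (rule delta_closed_subset[OF fS])
    have "isometry (submetric ?m (f ` S)) (submetric ?m (e ` S)) (e \<circ> ?i)"
    proof (rule isometryI)
      have "(e \<circ> ?i) ` f ` S = e ` S"
        unfolding image_comp[symmetric] inv_into_image_cancel[OF isometry_inj[OF iso] ST] ..
      then show "(e \<circ> ?i) ` mspace (submetric ?m (f ` S)) = mspace (submetric ?m (e ` S))"
        using fSm eSm by (simp add: Int_absorb2)
      fix x y assume "x \<in> mspace (submetric ?m (f ` S))" "y \<in> mspace (submetric ?m (f ` S))"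
      then obtain u v where uv: "u \<in> S" "v \<in> S" "x = f u" "y = f v" by auto
      then have "u \<in> mspace T" "v \<in> mspace T" using ST by auto
      then have "mdist ?m x y = mdist T u v" using closed_embedding_dist[OF f] uv by simp
      then show "mdist (submetric ?m (e ` S)) ((e \<circ> ?i) x) ((e \<circ> ?i) y) =
          mdist (submetric ?m (f ` S)) x y"
        using uv i e by simp
    qed
    then have "marked_iso (marked_subspace M (f ` S)) (marked_subspace M (e ` S)) (e \<circ> ?i)"
      by (intro marked_iso_closed_marks[OF _ marks_marked_subspace[OF M m1]
            marks_marked_subspace[OF M m2]]) (simp add: marked_subspace_def)
    then obtain h where h: "marked_iso M M h" "\<forall>x\<in>f ` S. h x = (e \<circ> ?i) x"
      using lim m1 m2 unfolding marked_fraisse_limit_def by blast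
    have "isometry ?m ?m h" using h(1) by (simp add: marked_iso_def)
    moreover have "mspace ?m \<noteq> {}" using eSm delta_closed_nonempty[OF eS] by blast
    ultimately have "closed_embedding \<delta> T ?m (h \<circ> f)"
      by (rule closed_embedding_comp[OF f isometry_closed_embedding])
    moreover have "(h \<circ> f) x = e x" if "x \<in> S" for x using h(2) i that by simp
    ultimately show "\<exists>e'. closed_embedding \<delta> T ?m e' \<and> (\<forall>x\<in>S. e' x = e x)" by blast
  qed
  ultimately show "hyperbolic_limit \<delta> ?m" using chain unfolding hyperbolic_limit_def by blast
qed

text \<open>Closed sets are nonempty, so the empty relation cannot start the back and forth; a
  single pair of points can.\<close>

lemma hyperbolic_limit_unique:
  assumes "0 \<le> \<delta>" and m: "hyperbolic_limit \<delta> m" and m': "hyperbolic_limit \<delta> m'"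
  shows "\<exists>h. isometry m m' h"
proof -
  obtain x y where xy: "x \<in> mspace m" "y \<in> mspace m'"
    using hyperbolic_limit_point[OF m] hyperbolic_limit_point[OF m'] by blast
  have "partial_isometry \<delta> m m' ((\<lambda>x. (x, y)) ` {x})"
    by (rule partial_isometry_graph)
      (use xy delta_closed_singleton[OF assms(1) xy(1)] delta_closed_singleton[OF assms(1) xy(2)] in auto)
  then show ?thesis using back_and_forth[OF m m'] by blast
qed

text \<open>Existence is fixed on \<open>nat\<close> because a finite type has no room for spaces of
  every finite size. The other claims concern limits on arbitrary types.\<close>

theorem corollary3p15:
  fixes \<delta> :: real
  assumes "\<delta> \<ge> 0"
  shows
    "(\<exists>H :: nat marked. marked_fraisse_limit (hyperbolic_class \<delta>) H) \<and>
     (\<forall>(H :: 'a marked) (K :: 'b marked).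
        marked_fraisse_limit (hyperbolic_class \<delta>) H \<and> marked_fraisse_limit (hyperbolic_class \<delta>) K
        \<longrightarrow> (\<exists>f. marked_iso H K f)) \<and>
     (\<forall>H :: 'a marked. marked_fraisse_limit (hyperbolic_class \<delta>) H \<longrightarrow>
        (\<forall>X :: 'c metric.
           finite (mspace X) \<and> mspace X \<noteq> {} \<and> hyperbolic \<delta> X \<and> rational_distances X \<longrightarrow>
           (\<exists>S f. delta_closed \<delta> (space_of H) S \<and> isometry X (submetric (space_of H) S) f)) \<and>
        (\<forall>S T f.
           finite S \<and> finite T \<and> delta_closed \<delta> (space_of H) S \<and> delta_closed \<delta> (space_of H) T \<and>
           isometry (submetric (space_of H) S) (submetric (space_of H) T) f \<longrightarrow>
           (\<exists>h. isometry (space_of H) (space_of H) h \<and> (\<forall>x\<in>S. h x = f x))))"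
proof (intro conjI allI impI)
  obtain m :: "nat metric" where "hyperbolic_limit \<delta> m"
    by (rule hyperbolic_limit_exists[OF assms])
  then show "\<exists>H :: nat marked. marked_fraisse_limit (hyperbolic_class \<delta>) H"
    using hyperbolic_limit_marked_fraisse_limit[OF assms] by blast
next
  fix H :: "'a marked" and K :: "'b marked"
  assume HK: "marked_fraisse_limit (hyperbolic_class \<delta>) H \<and> marked_fraisse_limit (hyperbolic_class \<delta>) K"
  note H = marked_fraisse_limit_D[OF conjunct1[OF HK]] and K = marked_fraisse_limit_D[OF conjunct2[OF HK]]
  obtain f where "isometry (space_of H) (space_of K) f"
    using hyperbolic_limit_unique[OF assms H(2) K(2)] by blast
  then show "\<exists>f. marked_iso H K f"
    using marked_iso_closed_marks[OF _ H(1) K(1)] by blast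
next
  fix H :: "'a marked" and X :: "'c metric"
  assume H: "marked_fraisse_limit (hyperbolic_class \<delta>) H"
    and X: "finite (mspace X) \<and> mspace X \<noteq> {} \<and> hyperbolic \<delta> X \<and> rational_distances X"
  obtain f where f: "closed_embedding \<delta> X (space_of H) f"
    using hyperbolic_limit_universal[OF assms marked_fraisse_limit_D(2)[OF H]] X
    unfolding finite_hyperbolic_def by blast
  show "\<exists>S f. delta_closed \<delta> (space_of H) S \<and> isometry X (submetric (space_of H) S) f"
    using closed_embedding_closed[OF f] closed_embedding_isometry[OF f] by blast
next
  fix H :: "'a marked" and S T f
  assume H: "marked_fraisse_limit (hyperbolic_class \<delta>) H"
    and f: "finite S \<and> finite T \<and> delta_closed \<delta> (space_of H) S \<and> delta_closed \<delta> (space_of H) T \<and>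
      isometry (submetric (space_of H) S) (submetric (space_of H) T) f"
  show "\<exists>h. isometry (space_of H) (space_of H) h \<and> (\<forall>x\<in>S. h x = f x)"
    by (rule hyperbolic_limit_homogeneous[OF marked_fraisse_limit_D(2)[OF H], of S T])
      (use f in \<open>auto simp: closed_marks_def\<close>)
qed

end
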